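(* Let $q > 1$, $\nu > -1$, $t = \frac{\nu+2}{q}$, $\beta > \max\left(\frac{\nu}{q}, \frac{\nu+2}{q}-1\right)$, and let $f \in A^\infty_{\frac{\nu+2}{q}}(\mathbb{C}_+)$. Put $$l_1 = \mathrm{dist}_{A^\infty_{\frac{\nu+2}{q}}(\mathbb{C}_+)}\bigl(f, A^q_\nu(\mathbb{C}_+)\bigr)$$ and $$l_2 = \inf\left\{\epsilon > 0 : \int_{\mathbb{C}_+}\left(\int_{V_{\epsilon,t}(f)} \frac{(\Im w)^{\beta-t}\, dm_2(w)}{|\overline{w}-z|^{\beta+2}}\right)^q (\Im z)^\nu\, dm_2(z) < \infty\right\},$$ where $V_{\epsilon,t}(f) = \{z = x+iy \in \mathbb{C}_+ : |f(x+iy)|\,y^t \geq \epsilon\}$. Then $l_1 = l_2$.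
   Context: $\mathbb{C}_+ = \{x+iy : y > 0\}$ is the upper half-plane, $H(\mathbb{C}_+)$ is the space of holomorphic functions on $\mathbb{C}_+$, and $m_2$ is two-dimensional Lebesgue measure. For $\alpha > -1$ and $0 < p < \infty$, the weighted Bergman space $A^p_\alpha(\mathbb{C}_+)$ consists of all $f \in H(\mathbb{C}_+)$ with $$\|f\|_{p,\alpha} = \left(\int_0^\infty\int_{-\infty}^\infty |f(x+iy)|^p y^\alpha\, dx\, dy\right)^{1/p} < \infty.$$ For $\mu > 0$, $A^\infty_\mu(\mathbb{C}_+)$ consists of all $F \in H(\mathbb{C}_+)$ with $$\|F\|_{A^\infty_\mu} = \sup_{y>0}\sup_{x\in\mathbb{R}} |F(x+iy)|\, y^\mu < \infty.$$ For a normed space $Y$, a subset $X \subset Y$ and $f\in Y$, $\mathrm{dist}_Y(f,X) = \inf_{g\in X}\|f-g\|_Y$. The infimum of the empty set is $+\infty$. *)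

theory Defs
  imports "HOL-Analysis.Analysis"
begin

definition upper_half_plane :: "complex set" where
  "upper_half_plane = {z. Im z > 0}"

(* Real powers on [0,\<infinity>] for exponents r > 0, so that 0 is sent to 0 and \<infinity> to \<infinity>. *)
definition ennreal_powr :: "ennreal \<Rightarrow> real \<Rightarrow> ennreal" where
  "ennreal_powr x r = (if x = \<infinity> then \<infinity> else ennreal (enn2real x powr r))"

(* Norms take values in [0,\<infinity>]; the space consists of the holomorphic functions of finite norm.
   Elements are functions on all of the complex plane whose values off the upper half-plane
   are irrelevant. *)

definition bergman_norm :: "real \<Rightarrow> real \<Rightarrow> (complex \<Rightarrow> complex) \<Rightarrow> ennreal" where
  "bergman_norm p \<alpha> f =
     ennreal_powr
       (\<integral>\<^sup>+y\<in>{0<..}. (\<integral>\<^sup>+x. ennreal (norm (f (Complex x y)) powr p * y powr \<alpha>) \<partial>lborel) \<partial>lborel)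
       (1 / p)"

definition bergman_space :: "real \<Rightarrow> real \<Rightarrow> (complex \<Rightarrow> complex) set" where
  "bergman_space p \<alpha> = {f. f holomorphic_on upper_half_plane \<and> bergman_norm p \<alpha> f < \<infinity>}"

definition bergman_inf_norm :: "real \<Rightarrow> (complex \<Rightarrow> complex) \<Rightarrow> ennreal" where
  "bergman_inf_norm \<mu> F =
     (SUP y\<in>{0<..}. SUP x. ennreal (norm (F (Complex x y)) * y powr \<mu>))"

definition bergman_inf_space :: "real \<Rightarrow> (complex \<Rightarrow> complex) set" where
  "bergman_inf_space \<mu> = {F. F holomorphic_on upper_half_plane \<and> bergman_inf_norm \<mu> F < \<infinity>}"

(* Distance from f to X with respect to the extended norm N; the infimum over {} is \<infinity>. *)
definition norm_dist ::
    "((complex \<Rightarrow> complex) \<Rightarrow> ennreal) \<Rightarrow> (complex \<Rightarrow> complex) \<Rightarrow> (complex \<Rightarrow> complex) set \<Rightarrow> ennreal"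
  where "norm_dist N f X = (INF g\<in>X. N (\<lambda>z. f z - g z))"

definition level_set :: "real \<Rightarrow> real \<Rightarrow> (complex \<Rightarrow> complex) \<Rightarrow> complex set" where
  "level_set \<epsilon> t f = {z \<in> upper_half_plane. norm (f z) * Im z powr t \<ge> \<epsilon>}"

end

theory Submission
  imports Defs "HOL-Complex_Analysis.Cauchy_Integral_Formula"
begin

text \<open>
  Both sides of the formula equal the limit superior of \<open>|f(z)| (Im z)\<^sup>t\<close> as \<open>z\<close> approaches the boundary
  of the half-plane, infinity included; equivalently, the infimum of those levels whose level sets
  are relatively compact, that is, contained in some set \<open>{z. 1/R \<le> Im z \<and> |z| \<le> R}\<close>.

  Level sets are rigid. If \<open>h\<close> has finite weighted supremum norm, then \<open>|h| y\<^sup>t\<close> is uniformly continuous for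
  the hyperbolic metric (lemma \<open>hyperbolic_uniform_continuity\<close>), so about each point of a level set
  there is a hyperbolic disc of fixed radius inside any lower level set. Such discs have a fixed
  positive hyperbolic area; hence a level set whose neighbourhood has finite area is relatively
  compact (lemma \<open>finite_area_imp_in_half_plane_box\<close>). Because of \<open>tq = \<nu> + 2\<close>, finiteness of
  the kernel integral at level \<open>\<epsilon>\<close> is such a finite-area condition for the level sets above \<open>\<epsilon>\<close>, and
  for a function of finite weighted supremum norm, membership in \<open>A\<^sup>q\<^sub>\<nu>\<close> is one for its level sets
  at all positive heights. Conversely, over a relatively compact level set the kernel integral converges.

  If \<open>g\<close> belongs to \<open>A\<^sup>q\<^sub>\<nu>\<close> and \<open>f - g\<close> has norm \<open>D\<close>, the level set of \<open>f\<close> at \<open>D + e\<close> lies in that of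
  \<open>g\<close> at \<open>e\<close>, which is relatively compact; this gives \<open>l\<^sub>2 \<le> l\<^sub>1\<close>.

  For \<open>l\<^sub>1 \<le> l\<^sub>2\<close>, splitting the Bergman reproducing formula over the level set would only bound
  \<open>l\<^sub>1\<close> by a multiple of \<open>l\<^sub>2\<close>. The constant one comes from a gliding hump instead: \<open>f\<close> is a locally
  uniform limit of functions of \<open>A\<^sup>q\<^sub>\<nu>\<close> that vanish at the boundary and share the weighted bound of \<open>f\<close>. Averaging \<open>N\<close>
  of them, chosen successively far apart, makes the large errors occur in essentially disjoint regions, so
  that they contribute only \<open>O(1/N)\<close> (lemma \<open>gliding_hump\<close>).
\<close>

section \<open>Norms and integrals on the half-plane\<close>

lemma open_upper_half_plane: "open upper_half_plane"
  unfolding upper_half_plane_def by (rule open_halfspace_Im_gt)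

lemma borel_measurable_Im [measurable]: "Im \<in> borel_measurable borel"
  by (intro borel_measurable_continuous_onI continuous_intros)

lemma growth_bound_nonneg:
  assumes "\<And>z. z \<in> upper_half_plane \<Longrightarrow> norm (f z) * Im z powr t \<le> M"
  shows "M \<ge> 0"
  using assms[of \<i>] by (auto simp: upper_half_plane_def intro: order_trans[rotated])

lemma ennreal_powr_lower: "ennreal x \<le> X \<Longrightarrow> 0 \<le> x \<Longrightarrow> 0 < r \<Longrightarrow> ennreal (x powr r) \<le> ennreal_powr X r"
  by (cases X) (auto simp: ennreal_powr_def intro!: ennreal_leI powr_mono2)

lemma ennreal_powr_upper: "X \<le> ennreal x \<Longrightarrow> 0 \<le> x \<Longrightarrow> 0 < r \<Longrightarrow> ennreal_powr X r \<le> ennreal (x powr r)"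
  by (cases X) (auto simp: ennreal_powr_def top_unique intro!: ennreal_leI powr_mono2)

lemma ennreal_powr_less_top_iff: "ennreal_powr X r < \<infinity> \<longleftrightarrow> X < \<infinity>"
  by (auto simp: ennreal_powr_def less_top)

lemma bergman_inf_norm_le_iff:
  assumes "B \<ge> 0"
  shows "bergman_inf_norm \<mu> F \<le> ennreal B \<longleftrightarrow> (\<forall>z\<in>upper_half_plane. norm (F z) * Im z powr \<mu> \<le> B)"
proof -
  have "bergman_inf_norm \<mu> F \<le> ennreal B \<longleftrightarrow> (\<forall>y>0. \<forall>x. norm (F (Complex x y)) * y powr \<mu> \<le> B)"
    using assms by (auto simp: bergman_inf_norm_def SUP_le_iff)
  also have "\<dots> \<longleftrightarrow> (\<forall>z\<in>upper_half_plane. norm (F z) * Im z powr \<mu> \<le> B)"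
  proof safe
    fix z assume *: "\<forall>y>0. \<forall>x. norm (F (Complex x y)) * y powr \<mu> \<le> B" and "z \<in> upper_half_plane"
    then show "norm (F z) * Im z powr \<mu> \<le> B"
      using *[rule_format, of "Im z" "Re z"] by (simp add: upper_half_plane_def)
  next
    fix x y :: real assume *: "\<forall>z\<in>upper_half_plane. norm (F z) * Im z powr \<mu> \<le> B" and "0 < y"
    then show "norm (F (Complex x y)) * y powr \<mu> \<le> B"
      using *[rule_format, of "Complex x y"] by (simp add: upper_half_plane_def)
  qed
  finally show ?thesis .
qed

text \<open>
  The Bergman norm is an iterated integral while the kernel integrals are taken over the plane; this
  is the bridge between the two. The map \<open>(x, y) \<mapsto> x + iy\<close> preserves the measure of boxes, and boxes
  determine Lebesgue measure.
\<close>
lemma nn_integral_lborel_complex: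
  fixes F :: "complex \<Rightarrow> ennreal"
  assumes F: "F \<in> borel_measurable borel"
  shows "(\<integral>\<^sup>+z. F z \<partial>lborel) = (\<integral>\<^sup>+y. (\<integral>\<^sup>+x. F (Complex x y) \<partial>lborel) \<partial>lborel)"
proof -
  let ?P = "lborel \<Otimes>\<^sub>M lborel :: (real \<times> real) measure"
  let ?c = "\<lambda>p. Complex (fst p) (snd p)"
  have "continuous_on UNIV ?c"
    unfolding complex_eq_iff Complex_eq by (intro continuous_intros)
  then have c: "?c \<in> borel_measurable borel"
    by (rule borel_measurable_continuous_onI)
  then have c': "?c \<in> measurable ?P borel"
    by (simp add: lborel_prod)
  have "lborel = distr ?P borel ?c"
  proof (rule lborel_eqI)
    fix l u :: complex
    assume le: "\<And>b. b \<in> Basis \<Longrightarrow> l \<bullet> b \<le> u \<bullet> b"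
    have "?c -` box l u = box (Re l, Im l) (Re u, Im u)"
      by (auto simp: mem_box Basis_complex_def Basis_prod_def)
    then have "emeasure (distr ?P borel ?c) (box l u) = emeasure ?P (box (Re l, Im l) (Re u, Im u))"
      using c' by (subst emeasure_distr) (auto simp: lborel_prod)
    also have "\<dots> = (\<Prod>b\<in>Basis. ((Re u, Im u) - (Re l, Im l)) \<bullet> b)"
      using le[of 1] le[of \<i>]
      by (subst lborel_prod, subst emeasure_lborel_box)
         (auto simp: Basis_complex_def Basis_prod_def)
    also have "\<dots> = (\<Prod>b\<in>Basis. (u - l) \<bullet> b)"
      by (simp add: Basis_complex_def Basis_prod_def mult.commute)
    finally show "emeasure (distr ?P borel ?c) (box l u) = (\<Prod>b\<in>Basis. (u - l) \<bullet> b)" .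
  qed simp
  then have "(\<integral>\<^sup>+z. F z \<partial>lborel) = (\<integral>\<^sup>+z. F z \<partial>distr ?P borel ?c)"
    by (rule arg_cong)
  also have "\<dots> = (\<integral>\<^sup>+p. F (?c p) \<partial>?P)"
    using c' F by (intro nn_integral_distr) (auto)
  also have "\<dots> = (\<integral>\<^sup>+y. (\<integral>\<^sup>+x. F (Complex x y) \<partial>lborel) \<partial>lborel)"
    using lborel_pair.nn_integral_snd[of "\<lambda>p. F (?c p)"] c' F
    by (simp add: split_beta')
  finally show ?thesis .
qed

lemma nn_integral_upper_half_plane:
  assumes [measurable]: "G \<in> borel_measurable borel"
  shows "(\<integral>\<^sup>+z\<in>upper_half_plane. G z \<partial>lborel)
    = (\<integral>\<^sup>+y\<in>{0<..}. (\<integral>\<^sup>+x. G (Complex x y) \<partial>lborel) \<partial>lborel)"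
proof -
  have "(\<lambda>z. G z * indicator upper_half_plane z) \<in> borel_measurable borel"
    using borel_open[OF open_upper_half_plane] by simp
  then have "(\<integral>\<^sup>+z\<in>upper_half_plane. G z \<partial>lborel)
    = (\<integral>\<^sup>+y. (\<integral>\<^sup>+x. G (Complex x y) * indicator upper_half_plane (Complex x y) \<partial>lborel) \<partial>lborel)"
    by (rule nn_integral_lborel_complex)
  also have "\<dots> = (\<integral>\<^sup>+y\<in>{0<..}. (\<integral>\<^sup>+x. G (Complex x y) \<partial>lborel) \<partial>lborel)"
    by (intro nn_integral_cong) (simp add: indicator_def upper_half_plane_def)
  finally show ?thesis .
qed

lemma inverse_one_plus_square_nn_integral:
  "(\<integral>\<^sup>+x. ennreal (1 / (1 + x\<^sup>2)) \<partial>lborel) < \<infinity>"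
proof -
  let ?f = "\<lambda>x::real. ennreal (1 / (1 + x\<^sup>2))"
  have fin: "(\<integral>\<^sup>+x. ?f x * indicator {0..} x \<partial>lborel) = pi / 2 - arctan 0"
  proof (rule nn_integral_FTC_atLeast)
    show "(arctan \<longlongrightarrow> pi / 2) at_top" by (rule tendsto_arctan_at_top)
  qed (auto intro!: derivative_eq_intros simp: divide_inverse add_nonneg_nonneg)
  have refl: "(\<integral>\<^sup>+x. ?f x * indicator {..0} x \<partial>lborel) = (\<integral>\<^sup>+x. ?f x * indicator {0..} x \<partial>lborel)"
    by (subst nn_integral_real_affine[where c = "-1" and t = 0])
       (auto intro!: nn_integral_cong simp: indicator_def)
  have "(\<integral>\<^sup>+x. ?f x \<partial>lborel)
      \<le> (\<integral>\<^sup>+x. ?f x * indicator {0..} x + ?f x * indicator {..0} x \<partial>lborel)"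
    by (intro nn_integral_mono) (auto simp: indicator_def)
  also have "\<dots> < \<infinity>"
    by (subst nn_integral_add) (auto simp: refl fin)
  finally show ?thesis .
qed

lemma powr_decay_nn_integral:
  fixes \<nu> s :: real
  assumes "\<nu> > -1" "s > \<nu> + 1"
  shows "(\<integral>\<^sup>+y\<in>{0<..}. ennreal (y powr \<nu> * (1 + y) powr (-s)) \<partial>lborel) < \<infinity>"
proof -
  have 1: "integral\<^sup>N lborel (\<lambda>y. indicator {0..1} y * (y powr \<nu>)) = ennreal (1 powr (\<nu> + 1) / (\<nu> + 1))"
    by (rule nn_integral_has_integral_lebesgue[OF _ has_integral_powr_from_0]) (use assms in auto)
  have 2: "integral\<^sup>N lborel (\<lambda>y. indicator {1..} y * (y powr (\<nu> - s))) = ennreal (- (1 powr (\<nu> - s + 1)) / (\<nu> - s + 1))"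
    by (rule nn_integral_has_integral_lebesgue[OF _ has_integral_powr_to_inf]) (use assms in auto)
  have "(\<integral>\<^sup>+y\<in>{0<..}. ennreal (y powr \<nu> * (1 + y) powr (-s)) \<partial>lborel)
     \<le> (\<integral>\<^sup>+y. ennreal (indicator {0..1} y * (y powr \<nu>)) + ennreal (indicator {1..} y * (y powr (\<nu> - s))) \<partial>lborel)"
  proof (intro nn_integral_mono)
    fix y :: real
    show "ennreal (y powr \<nu> * (1 + y) powr (-s)) * indicator {0<..} y
      \<le> ennreal (indicator {0..1} y * (y powr \<nu>)) + ennreal (indicator {1..} y * (y powr (\<nu> - s)))"
    proof (cases "y > 0")
      case True
      have s: "s > 0" using assms by linarith
      show ?thesis
      proof (cases "y \<le> 1")
        case le: True
        have "(1 + y) powr (-s) \<le> 1"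
          using True s powr_mono[of "-s" 0 "1 + y"] by simp
        then have "y powr \<nu> * (1 + y) powr (-s) \<le> y powr \<nu>"
          by (simp add: mult_left_le)
        then have "ennreal (y powr \<nu> * (1 + y) powr (-s)) \<le> ennreal (y powr \<nu>)"
          by (rule ennreal_leI)
        also have "\<dots> \<le> ennreal (indicator {0..1} y * (y powr \<nu>)) + ennreal (indicator {1..} y * (y powr (\<nu> - s)))"
          using True le by (simp add: indicator_def)
        finally show ?thesis
          using True by simp
      next
        case False
        have "(1 + y) powr (-s) \<le> y powr (-s)"
          using True s by (intro powr_mono2') auto
        then have "y powr \<nu> * (1 + y) powr (-s) \<le> y powr (\<nu> - s)"
          using mult_left_mono[of "(1 + y) powr (-s)" "y powr (-s)" "y powr \<nu>"]
          by (simp add: powr_add[symmetric])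
        then have "ennreal (y powr \<nu> * (1 + y) powr (-s)) \<le> ennreal (y powr (\<nu> - s))"
          by (rule ennreal_leI)
        then show ?thesis
          using True False by (simp add: indicator_def)
      qed
    qed auto
  qed
  also have "\<dots> < \<infinity>"
    by (subst nn_integral_add) (auto simp: 1 2)
  finally show ?thesis .
qed

text \<open>
  Since \<open>|z + i|\<^sup>2 = x\<^sup>2 + (1 + y)\<^sup>2\<close> dominates both \<open>1 + x\<^sup>2\<close> and \<open>(1 + y)\<^sup>2\<close>, giving two of the \<open>a\<close>
  powers to the first and the others to the second separates the variables.
\<close>
lemma shifted_decay_nn_integral:
  fixes \<nu> a :: real
  assumes \<nu>: "\<nu> > -1" and a: "a > \<nu> + 3"
  shows "(\<integral>\<^sup>+y\<in>{0<..}. (\<integral>\<^sup>+x. ennreal (norm (Complex x y + \<i>) powr (-a) * y powr \<nu>) \<partial>lborel) \<partial>lborel) < \<infinity>"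
proof -
  let ?f = "\<lambda>x::real. ennreal (1 / (1 + x\<^sup>2))"
  let ?g = "\<lambda>y::real. ennreal (y powr \<nu> * (1 + y) powr (-(a - 2)))"
  have bd: "norm (Complex x y + \<i>) powr (-a) \<le> 1 / (1 + x\<^sup>2) * (1 + y) powr (-(a - 2))" if y: "y > 0" for x y
  proof -
    let ?n = "norm (Complex x y + \<i>)"
    have n2: "?n\<^sup>2 = x\<^sup>2 + (1 + y)\<^sup>2"
      by (simp add: cmod_power2 add.commute)
    have "(1::real) \<le> (1 + y)\<^sup>2" using y by (simp add: power2_eq_square field_simps)
    then have *: "1 + x\<^sup>2 \<le> ?n\<^sup>2" unfolding n2 by simp
    have **: "1 + y \<le> ?n" by (rule power2_le_imp_le) (auto simp: n2)
    have pos: "?n > 0" using ** y by linarith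
    have "?n powr (-a) = ?n powr (-2) * ?n powr (-(a - 2))"
      by (simp add: powr_add[symmetric])
    also have "?n powr (-2) = 1 / ?n\<^sup>2"
      using pos by (simp add: powr_minus powr_numeral divide_inverse)
    also have "1 / ?n\<^sup>2 * ?n powr (-(a - 2)) \<le> 1 / (1 + x\<^sup>2) * (1 + y) powr (-(a - 2))"
      using * ** y a \<nu> pos
      by (intro mult_mono divide_left_mono powr_mono2')
         (auto intro!: mult_pos_pos add_pos_nonneg simp: zero_less_power2)
    finally show ?thesis .
  qed
  have "(\<integral>\<^sup>+y\<in>{0<..}. (\<integral>\<^sup>+x. ennreal (norm (Complex x y + \<i>) powr (-a) * y powr \<nu>) \<partial>lborel) \<partial>lborel)
     \<le> (\<integral>\<^sup>+y. (\<integral>\<^sup>+x. ?f x * (?g y * indicator {0<..} y) \<partial>lborel) \<partial>lborel)"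
  proof (intro nn_integral_mono)
    fix y :: real
    show "(\<integral>\<^sup>+x. ennreal (norm (Complex x y + \<i>) powr (-a) * y powr \<nu>) \<partial>lborel) * indicator {0<..} y
      \<le> (\<integral>\<^sup>+x. ?f x * (?g y * indicator {0<..} y) \<partial>lborel)"
    proof (cases "y > 0")
      case True
      have "ennreal (norm (Complex x y + \<i>) powr (-a) * y powr \<nu>) \<le> ?f x * ?g y" for x
      proof -
        have "norm (Complex x y + \<i>) powr (-a) * y powr \<nu>
            \<le> (1 / (1 + x\<^sup>2) * (1 + y) powr (-(a - 2))) * y powr \<nu>"
          using bd[OF True] by (intro mult_right_mono) auto
        then show ?thesis
          by (subst ennreal_mult[symmetric]) (auto intro!: ennreal_leI simp: mult_ac)
      qed
      then show ?thesis using True by (auto intro!: nn_integral_mono)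
    qed auto
  qed
  also have "\<dots> = (\<integral>\<^sup>+x. ?f x \<partial>lborel) * (\<integral>\<^sup>+y. ?g y * indicator {0<..} y \<partial>lborel)"
    by (subst nn_integral_multc, simp, subst nn_integral_cmult) auto
  also have "\<dots> < \<infinity>"
    using inverse_one_plus_square_nn_integral powr_decay_nn_integral[OF \<nu>, of "a - 2"] a
    by (auto simp: ennreal_mult_less_top)
  finally show ?thesis .
qed

lemma decay_nn_integral:
  fixes \<nu> a K :: real
  assumes "\<nu> > -1" "a > \<nu> + 3" "K \<ge> 0"
  shows "(\<integral>\<^sup>+z\<in>upper_half_plane. ennreal (K * (norm (z + \<i>) powr (-a) * Im z powr \<nu>)) \<partial>lborel) < \<infinity>"
proof -
  let ?G = "\<lambda>z. ennreal (norm (z + \<i>) powr (-a) * Im z powr \<nu>)"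
  have G[measurable]: "?G \<in> borel_measurable borel" by measurable
  have U: "upper_half_plane \<in> sets borel" by (rule borel_open[OF open_upper_half_plane])
  have "(\<integral>\<^sup>+z\<in>upper_half_plane. ennreal (K * (norm (z + \<i>) powr (-a) * Im z powr \<nu>)) \<partial>lborel)
      = (\<integral>\<^sup>+z. ennreal K * (?G z * indicator upper_half_plane z) \<partial>lborel)"
    using assms by (intro nn_integral_cong) (simp add: ennreal_mult mult.assoc)
  also have "\<dots> = ennreal K * (\<integral>\<^sup>+z\<in>upper_half_plane. ?G z \<partial>lborel)"
    using U by (intro nn_integral_cmult) simp
  also have "\<dots> < \<infinity>"
    using shifted_decay_nn_integral[OF assms(1,2)]
    by (simp add: nn_integral_upper_half_plane[OF G] ennreal_mult_less_top)
  finally show ?thesis .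
qed

section \<open>Growth functions are uniformly continuous at the hyperbolic scale\<close>

text \<open>
  At the hyperbolic scale all heights are comparable; this turns that into a comparison of powers of
  either sign.
\<close>
lemma powr_comparable:
  fixes x y a :: real
  assumes "0 < y" "y / 2 \<le> x" "x \<le> 2 * y"
  shows "2 powr (-\<bar>a\<bar>) * y powr a \<le> x powr a"
proof (cases "a \<ge> 0")
  case True
  have "2 powr (-\<bar>a\<bar>) * y powr a = (y / 2) powr a"
    using True assms by (simp add: powr_divide powr_minus field_simps)
  also have "\<dots> \<le> x powr a"
    using True assms by (intro powr_mono2) auto
  finally show ?thesis .
next
  case False
  have "2 powr (-\<bar>a\<bar>) * y powr a = (2 * y) powr a"
    using False assms by (simp add: powr_mult)
  also have "\<dots> \<le> x powr a"
    using False assms by (intro powr_mono2') auto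
  finally show ?thesis .
qed

lemma Im_comparable_in_ball:
  assumes "w \<in> ball z (\<rho> * Im z)" "\<rho> \<le> 1 / 2" "Im z > 0"
  shows "Im z / 2 \<le> Im w" "Im w \<le> 2 * Im z" "\<bar>Im w - Im z\<bar> \<le> \<rho> * Im z"
proof -
  have "\<bar>Im w - Im z\<bar> \<le> norm (w - z)"
    using abs_Im_le_cmod[of "w - z"] by simp
  also have "\<dots> < \<rho> * Im z" using assms(1) by (simp add: dist_norm norm_minus_commute)
  finally have *: "\<bar>Im w - Im z\<bar> < \<rho> * Im z" .
  moreover have "\<rho> * Im z \<le> 1 / 2 * Im z"
    using assms by (intro mult_right_mono) auto
  ultimately show "Im z / 2 \<le> Im w" "Im w \<le> 2 * Im z" "\<bar>Im w - Im z\<bar> \<le> \<rho> * Im z"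
    using assms(3) by linarith+
qed

text \<open>
  Cauchy's estimate on the disc of radius \<open>Im z / 2\<close>, where the height is at least \<open>Im z / 2\<close>.
\<close>
lemma deriv_bound_half_plane:
  fixes h :: "complex \<Rightarrow> complex"
  assumes hol: "h holomorphic_on upper_half_plane"
    and bd: "\<And>z. z \<in> upper_half_plane \<Longrightarrow> norm (h z) * Im z powr t \<le> M"
    and t: "t \<ge> 0" and y: "Im z > 0"
  shows "norm (deriv h z) \<le> 2 * 2 powr t * M * Im z powr (- t) / Im z"
proof -
  have sub: "cball z (Im z / 2) \<subseteq> upper_half_plane"
  proof
    fix w assume "w \<in> cball z (Im z / 2)"
    then have "\<bar>Im (w - z)\<bar> \<le> Im z / 2"
      using abs_Im_le_cmod[of "w - z"] by (simp add: dist_norm norm_minus_commute)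
    then show "w \<in> upper_half_plane" using y abs_ge_minus_self[of "Im (w - z)"] by (simp add: upper_half_plane_def)
  qed
  have "norm ((deriv ^^ 1) h z) \<le> fact 1 * (2 powr t * M * Im z powr (- t)) / (Im z / 2) ^ 1"
  proof (rule Cauchy_inequality)
    show "h holomorphic_on ball z (Im z / 2)"
      using sub ball_subset_cball holomorphic_on_subset[OF hol] by blast
    show "continuous_on (cball z (Im z / 2)) h"
      using sub holomorphic_on_subset[OF hol] holomorphic_on_imp_continuous_on by blast
    show "Im z / 2 > 0" using y by simp
  next
    fix w assume w: "norm (z - w) = Im z / 2"
    then have wu: "w \<in> upper_half_plane" using sub by (auto simp: dist_norm)
    have "\<bar>Im (w - z)\<bar> \<le> Im z / 2"
      using abs_Im_le_cmod[of "w - z"] w by (simp add: norm_minus_commute)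
    then have "Im z / 2 \<le> Im w" using abs_ge_minus_self[of "Im (w - z)"] by simp
    then have "Im z powr t \<le> (2 * Im w) powr t"
      using y t by (intro powr_mono2) auto
    also have "\<dots> = 2 powr t * Im w powr t"
      using wu by (subst powr_mult) (auto simp: upper_half_plane_def)
    finally have "norm (h w) * Im z powr t \<le> norm (h w) * (2 powr t * Im w powr t)"
      by (intro mult_left_mono) auto
    also have "\<dots> \<le> 2 powr t * M"
      using mult_left_mono[OF bd[OF wu], of "2 powr t"] by (simp add: mult_ac)
    finally show "norm (h w) \<le> 2 powr t * M * Im z powr (- t)"
      using y by (simp add: powr_minus divide_inverse[symmetric] field_simps)
  qed
  then show ?thesis by (simp add: field_simps)
qed

text \<open>
  Replacing \<open>h(z)\<close> by \<open>a\<^sup>t h(az + b)\<close> with \<open>a > 0\<close> and \<open>b\<close> real preserves the bound \<open>M\<close>, so the modulus of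
  continuity, measured relative to \<open>Im z\<close>, can be chosen independently of the point.
  The derivative bound controls the variation of \<open>h\<close>, and continuity of \<open>x \<mapsto> x\<^sup>t\<close> at \<open>1\<close> that of the
  weight.
\<close>
lemma hyperbolic_uniform_continuity:
  fixes h :: "complex \<Rightarrow> complex"
  assumes hol: "h holomorphic_on upper_half_plane"
    and bd: "\<And>z. z \<in> upper_half_plane \<Longrightarrow> norm (h z) * Im z powr t \<le> M"
    and t: "t \<ge> 0" and \<kappa>: "\<kappa> > 0"
  obtains \<rho> where "0 < \<rho>" "\<rho> \<le> 1 / 2"
    "\<And>z w. Im z > 0 \<Longrightarrow> w \<in> ball z (\<rho> * Im z) \<Longrightarrow> norm (h w) * Im w powr t \<ge> norm (h z) * Im z powr t - \<kappa>"
proof -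
  have M: "M \<ge> 0" using bd by (rule growth_bound_nonneg)
  \<comment> \<open>\<open>C * \<rho>\<close> bounds the part of the variation due to \<open>h\<close>: the derivative bound, times the radius \<open>\<rho> * Im z\<close>,
    times the weight; the powers of two compare heights in the disc.\<close>
  define C where "C = 2 * 2 powr t * M * 2 powr t * 2 * 2 powr t"
  have C: "C \<ge> 0" using M by (simp add: C_def)
  have "isCont (\<lambda>x::real. x powr t) 1" by (intro continuous_intros) auto
  moreover have "\<kappa> / (2 * (M + 1)) > 0" using \<kappa> M by simp
  ultimately have "\<exists>d>0. \<forall>x. dist x 1 < d \<longrightarrow> dist (x powr t) (1 powr t) < \<kappa> / (2 * (M + 1))"
    unfolding continuous_at_eps_delta by blast
  then obtain d where d: "d > 0" "\<And>x. \<bar>x - 1\<bar> < d \<Longrightarrow> \<bar>x powr t - 1\<bar> < \<kappa> / (2 * (M + 1))"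
    unfolding dist_real_def by auto
  define e where "e = \<kappa> / (2 * (C + 1))"
  have e: "e > 0" using \<kappa> C by (simp add: e_def)
  define \<rho> where "\<rho> = min (1 / 2) (min (d / 2) e)"
  have \<rho>: "0 < \<rho>" "\<rho> \<le> 1 / 2" "\<rho> < d" "\<rho> \<le> \<kappa> / (2 * (C + 1))"
    using d(1) e unfolding e_def[symmetric] by (auto simp: \<rho>_def min_def)
  have C\<rho>: "C * \<rho> \<le> \<kappa> / 2"
  proof -
    have "C * \<rho> \<le> (C + 1) * (\<kappa> / (2 * (C + 1)))"
      using \<rho> C by (intro mult_mono) auto
    also have "\<dots> = \<kappa> / 2" using C by (simp add: field_simps)
    finally show ?thesis .
  qed
  show thesis
  proof (rule that[OF \<rho>(1,2)])
    fix z w assume z: "Im z > 0" and w: "w \<in> ball z (\<rho> * Im z)"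
    note cw = Im_comparable_in_ball[OF w \<rho>(2) z]
    have "norm (h w - h z) \<le> (2 * 2 powr t * M * 2 powr t * Im z powr (- t) * 2 / Im z) * norm (w - z)"
    proof (rule field_differentiable_bound[of "ball z (\<rho> * Im z)"])
      fix u assume u: "u \<in> ball z (\<rho> * Im z)"
      note cu = Im_comparable_in_ball[OF u \<rho>(2) z]
      have iu: "Im u > 0" using cu z by linarith
      then have uu: "u \<in> upper_half_plane" by (simp add: upper_half_plane_def)
      show "(h has_field_derivative deriv h u) (at u within ball z (\<rho> * Im z))"
        using holomorphic_derivI[OF hol open_upper_half_plane uu] by blast
      have "Im u powr (- t) \<le> (Im z / 2) powr (- t)"
        using cu z t by (intro powr_mono2') auto
      also have "\<dots> = 2 powr t * Im z powr (- t)"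
        using z by (simp add: powr_divide powr_minus field_simps)
      finally have p: "Im u powr (- t) \<le> 2 powr t * Im z powr (- t)" .
      have "norm (deriv h u) \<le> 2 * 2 powr t * M * Im u powr (- t) / Im u"
        by (rule deriv_bound_half_plane[OF hol bd t iu])
      also have "\<dots> \<le> 2 * 2 powr t * M * (2 powr t * Im z powr (- t)) / (Im z / 2)"
        using p cu z M by (intro frac_le mult_left_mono) auto
      finally show "norm (deriv h u) \<le> 2 * 2 powr t * M * 2 powr t * Im z powr (- t) * 2 / Im z"
        by (simp add: mult_ac)
    qed (use z w \<rho> in auto)
    also have "\<dots> \<le> (2 * 2 powr t * M * 2 powr t * Im z powr (- t) * 2 / Im z) * (\<rho> * Im z)"
      using w z M by (intro mult_left_mono) (auto simp: dist_norm norm_minus_commute)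
    also have "\<dots> = 2 * 2 powr t * M * 2 powr t * 2 * \<rho> * Im z powr (- t)"
      using z by simp
    finally have "norm (h w - h z) * Im w powr t
        \<le> 2 * 2 powr t * M * 2 powr t * 2 * \<rho> * Im z powr (- t) * (2 * Im z) powr t"
      using cw z t M \<rho> by (intro mult_mono powr_mono2) auto
    also have "\<dots> = C * \<rho>"
      using z by (simp add: C_def powr_mult powr_minus field_simps)
    finally have 1: "norm (h w - h z) * Im w powr t \<le> \<kappa> / 2"
      using C\<rho> by linarith
    have "\<bar>Im w / Im z - 1\<bar> < d"
    proof -
      have "\<bar>Im w / Im z - 1\<bar> = \<bar>Im w - Im z\<bar> / Im z"
        using z by (simp add: abs_div_pos diff_divide_distrib)
      also have "\<dots> \<le> \<rho>" using cw(3) z by (simp add: field_simps)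
      finally show ?thesis using \<rho> by linarith
    qed
    from d(2)[OF this] have "\<bar>(Im w / Im z) powr t - 1\<bar> < \<kappa> / (2 * (M + 1))" .
    then have "(Im w / Im z) powr t \<ge> 1 - \<kappa> / (2 * (M + 1))" by linarith
    then have "(norm (h z) * Im z powr t) * (Im w / Im z) powr t
        \<ge> (norm (h z) * Im z powr t) * (1 - \<kappa> / (2 * (M + 1)))"
      by (intro mult_left_mono) auto
    moreover have "(norm (h z) * Im z powr t) * (Im w / Im z) powr t = norm (h z) * Im w powr t"
      using z cw by (simp add: powr_divide)
    moreover have "(norm (h z) * Im z powr t) * (\<kappa> / (2 * (M + 1))) \<le> (M + 1) * (\<kappa> / (2 * (M + 1)))"
      using bd[of z] z M \<kappa> by (intro mult_right_mono) (auto simp: upper_half_plane_def)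
    moreover have "(M + 1) * (\<kappa> / (2 * (M + 1))) = \<kappa> / 2" using M by (simp add: field_simps)
    ultimately have 2: "norm (h z) * Im w powr t \<ge> norm (h z) * Im z powr t - \<kappa> / 2"
      by (simp only: right_diff_distrib mult_1_right)
    have "norm (h z) \<le> norm (h w) + norm (h w - h z)"
      using norm_triangle_sub[of "h z" "h w"] by (simp add: norm_minus_commute)
    then have "norm (h z) * Im w powr t \<le> (norm (h w) + norm (h w - h z)) * Im w powr t"
      by (intro mult_right_mono) auto
    then show "norm (h w) * Im w powr t \<ge> norm (h z) * Im z powr t - \<kappa>"
      using 1 2 by (simp add: distrib_right)
  qed
qed

lemma hyperbolic_neighbourhood_in_level_set:
  assumes hol: "h holomorphic_on upper_half_plane"
    and bd: "\<And>z. z \<in> upper_half_plane \<Longrightarrow> norm (h z) * Im z powr t \<le> M"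
    and t: "t \<ge> 0" and \<eta>: "\<eta> < \<eta>'"
  obtains \<rho> where "0 < \<rho>" "\<rho> \<le> 1 / 2"
    "\<And>z. z \<in> level_set \<eta>' t h \<Longrightarrow> ball z (\<rho> * Im z) \<subseteq> level_set \<eta> t h"
proof -
  obtain \<rho> where \<rho>: "0 < \<rho>" "\<rho> \<le> 1 / 2"
    "\<And>z w. Im z > 0 \<Longrightarrow> w \<in> ball z (\<rho> * Im z) \<Longrightarrow>
       norm (h w) * Im w powr t \<ge> norm (h z) * Im z powr t - (\<eta>' - \<eta>)"
    using hyperbolic_uniform_continuity[OF hol bd t, of "\<eta>' - \<eta>"] \<eta> by auto
  show thesis
  proof (rule that[OF \<rho>(1,2)], rule subsetI)
    fix z w assume z: "z \<in> level_set \<eta>' t h" and w: "w \<in> ball z (\<rho> * Im z)"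
    have y: "Im z > 0" using z by (simp add: level_set_def upper_half_plane_def)
    have "Im w > 0" using Im_comparable_in_ball[OF w \<rho>(2) y] y by linarith
    then show "w \<in> level_set \<eta> t h"
      using \<rho>(3)[OF y w] z by (simp add: level_set_def upper_half_plane_def)
  qed
qed

section \<open>Sets of finite hyperbolic area\<close>

text \<open>
  These compact sets exhaust the half-plane. A subset of the half-plane is relatively compact exactly
  if it lies in one of them, and a function vanishes at the boundary, infinity included, if each
  \<open>\<delta> > 0\<close> bounds it off one of them.
\<close>
definition half_plane_box :: "real \<Rightarrow> complex set" where
  "half_plane_box R = {z. 1 / R \<le> Im z \<and> norm z \<le> R}"

lemma half_plane_box_mono:
  "0 < R \<Longrightarrow> R \<le> S \<Longrightarrow> half_plane_box R \<subseteq> half_plane_box S"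
  by (auto simp: half_plane_box_def intro: order_trans[of "1/S" "1/R"] simp: frac_le)

lemma compact_half_plane_box: "compact (half_plane_box R)"
proof -
  have "half_plane_box R = {z. 1 / R \<le> Im z} \<inter> cball 0 R"
    by (auto simp: half_plane_box_def)
  then show ?thesis
    by (auto intro!: closed_Int_compact closed_halfspace_Im_ge)
qed

lemma half_plane_box_subset: "0 < R \<Longrightarrow> half_plane_box R \<subseteq> upper_half_plane"
  by (auto simp: half_plane_box_def upper_half_plane_def intro: less_le_trans[of 0 "1 / R"])

lemma ball_outside_half_plane_box:
  assumes z: "Im z > 0" "z \<notin> half_plane_box (2 * R)" and R: "R > 0" and \<rho>: "0 \<le> \<rho>" "\<rho> \<le> 1 / 2"
  shows "ball z (\<rho> * Im z) \<inter> half_plane_box R = {}"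
proof (rule ccontr)
  assume "ball z (\<rho> * Im z) \<inter> half_plane_box R \<noteq> {}"
  then obtain w where w: "w \<in> ball z (\<rho> * Im z)" "1 / R \<le> Im w" "norm w \<le> R"
    by (auto simp: half_plane_box_def)
  have "1 / (2 * R) \<le> Im z" using Im_comparable_in_ball[OF w(1) \<rho>(2) z(1)] w(2)
    by (simp add: field_simps)
  moreover have "norm z \<le> 2 * R"
  proof -
    have "norm z \<le> norm w + norm (z - w)" by (metis norm_triangle_sub)
    also have "norm (z - w) \<le> \<rho> * Im z" using w(1) by (simp add: dist_norm)
    also have "\<dots> \<le> 1 / 2 * norm z" using \<rho> z abs_Im_le_cmod[of z] by (intro mult_mono) auto
    finally show ?thesis using w by linarith
  qed
  ultimately show False using z(2) by (simp add: half_plane_box_def)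
qed

lemma emeasure_ball_complex: "r \<ge> 0 \<Longrightarrow> emeasure lborel (ball (z::complex) r) = ennreal (pi * r\<^sup>2)"
  using emeasure_ball[of r z] unit_ball_vol_even[of 1] by simp

text \<open>
  The area element \<open>y\<^sup>-\<^sup>2 dx dy\<close> is invariant, so every disc \<open>ball z (\<rho> * Im z)\<close> carries at least the fixed
  mass \<open>\<pi>\<rho>\<^sup>2/4\<close>. If \<open>V\<close> left every box, such discs would occur off every box, whereas a finite
  measure gives mass tending to zero to the complements of the boxes.
\<close>
lemma finite_area_imp_in_half_plane_box:
  fixes V :: "complex set"
  assumes V: "V \<subseteq> upper_half_plane" and \<rho>: "0 < \<rho>" "\<rho> \<le> 1 / 2" and c: "c > 0"
    and fin: "(\<integral>\<^sup>+z\<in>(\<Union>z\<in>V. ball z (\<rho> * Im z)). ennreal (c * Im z powr (- 2)) \<partial>lborel) < \<infinity>"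
  shows "\<exists>R>0. V \<subseteq> half_plane_box R"
proof (rule ccontr)
  assume neg: "\<not> ?thesis"
  define U where "U = (\<Union>z\<in>V. ball z (\<rho> * Im z))"
  have U: "open U" unfolding U_def by auto
  define \<phi> where "\<phi> = (\<lambda>z::complex. ennreal (c * Im z powr (- 2)) * indicator U z)"
  have \<phi>m: "\<phi> \<in> borel_measurable lborel"
    unfolding \<phi>_def using borel_open[OF U] by simp
  have "\<forall>n. \<exists>z\<in>V. z \<notin> half_plane_box (2 * (real n + 1))"
    using neg by (metis add_nonneg_pos mult_pos_pos of_nat_0_le_iff subsetI zero_less_numeral zero_less_one)
  then obtain \<zeta> where \<zeta>: "\<And>n. \<zeta> n \<in> V" "\<And>n. \<zeta> n \<notin> half_plane_box (2 * (real n + 1))"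
    by metis
  define A where "A = (\<lambda>n. upper_half_plane - half_plane_box (real n + 1))"
  have Am: "A n \<in> sets lborel" for n
    unfolding A_def upper_half_plane_def
    using compact_imp_closed[OF compact_half_plane_box] open_halfspace_Im_gt
    by (auto intro!: sets.Diff)
  have emp: "(\<Inter>n. A n) = {}"
  proof (rule ccontr)
    assume "(\<Inter>n. A n) \<noteq> {}"
    then obtain z where z: "\<And>n. z \<in> A n" by blast
    obtain n where n: "real n \<ge> max (1 / Im z) (norm z)" using real_arch_simple by blast
    have y: "Im z > 0" using z[of 0] by (simp add: A_def upper_half_plane_def)
    have "1 / Im z \<le> real n + 1" using n by simp
    then have "1 / (real n + 1) \<le> Im z" using y by (simp add: field_simps)
    moreover have "norm z \<le> real n + 1" using n by simp
    ultimately show False using z[of n] by (simp add: A_def half_plane_box_def)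
  qed
  \<comment> \<open>The measure with density \<open>c y\<^sup>-\<^sup>2\<close> on \<open>U\<close> is finite, so it is continuous along the decreasing sets \<open>A n\<close>.\<close>
  have tend: "(\<lambda>n. emeasure (density lborel \<phi>) (A n)) \<longlonglongrightarrow> emeasure (density lborel \<phi>) (\<Inter>n. A n)"
  proof (rule Lim_emeasure_decseq)
    show "range A \<subseteq> sets (density lborel \<phi>)" using Am by auto
    show "decseq A"
    proof (rule decseq_SucI)
      fix n show "A (Suc n) \<subseteq> A n"
        using half_plane_box_mono[of "real n + 1" "real (Suc n) + 1"] by (auto simp: A_def)
    qed
    fix n
    have "emeasure (density lborel \<phi>) (A n) \<le> (\<integral>\<^sup>+z. \<phi> z \<partial>lborel)"
      using \<phi>m Am by (subst emeasure_density) (auto intro!: nn_integral_mono simp: indicator_def)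
    also have "\<dots> < \<infinity>" using fin by (simp add: \<phi>_def U_def)
    finally show "emeasure (density lborel \<phi>) (A n) \<noteq> \<infinity>" by simp
  qed
  define m where "m = c * pi * \<rho>\<^sup>2 / 4"
  have m: "m > 0" using c \<rho> by (simp add: m_def)
  have "ennreal m \<le> emeasure (density lborel \<phi>) (A n)" for n
  proof -
    let ?z = "\<zeta> n" let ?B = "ball ?z (\<rho> * Im ?z)"
    have y: "Im ?z > 0" using \<zeta>(1) V by (auto simp: upper_half_plane_def)
    have BU: "?B \<subseteq> U" using \<zeta>(1) by (auto simp: U_def)
    have BA: "?B \<subseteq> A n"
    proof
      fix w assume w: "w \<in> ?B"
      have "w \<notin> half_plane_box (real n + 1)"
        using ball_outside_half_plane_box[OF y \<zeta>(2) _ less_imp_le[OF \<rho>(1)] \<rho>(2)] w by auto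
      moreover have "w \<in> upper_half_plane"
        using Im_comparable_in_ball[OF w \<rho>(2) y] y by (simp add: upper_half_plane_def)
      ultimately show "w \<in> A n" by (simp add: A_def)
    qed
    have "ennreal m = ennreal (c * (1 / (4 * (Im ?z)\<^sup>2))) * emeasure lborel ?B"
      using y \<rho> c by (subst emeasure_ball_complex)
        (auto simp: ennreal_mult[symmetric] m_def power2_eq_square)
    also have "\<dots> = (\<integral>\<^sup>+w. ennreal (c * (1 / (4 * (Im ?z)\<^sup>2))) * indicator ?B w \<partial>lborel)"
      by (simp add: nn_integral_cmult_indicator)
    also have "\<dots> \<le> (\<integral>\<^sup>+w. \<phi> w * indicator (A n) w \<partial>lborel)"
    proof (intro nn_integral_mono)
      fix w
      show "ennreal (c * (1 / (4 * (Im ?z)\<^sup>2))) * indicator ?B w \<le> \<phi> w * indicator (A n) w"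
      proof (cases "w \<in> ?B")
        case True
        note cw = Im_comparable_in_ball[OF True \<rho>(2) y]
        have iw: "Im w > 0" using cw y by linarith
        have "(Im w)\<^sup>2 \<le> (2 * Im ?z)\<^sup>2" using cw iw by (intro power_mono) auto
        then have "1 / (4 * (Im ?z)\<^sup>2) \<le> 1 / (Im w)\<^sup>2"
          using iw y by (intro divide_left_mono) (simp_all add: power_mult_distrib)
        also have "\<dots> = Im w powr (- 2)" using iw by (simp add: powr_minus powr_numeral divide_inverse)
        finally have "c * (1 / (4 * (Im ?z)\<^sup>2)) \<le> c * Im w powr (- 2)"
          using c by (intro mult_left_mono) auto
        moreover have "w \<in> U" "w \<in> A n" using True BU BA by blast+
        ultimately show ?thesis
          using True by (simp add: \<phi>_def ennreal_leI)
      qed simp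
    qed
    also have "\<dots> = emeasure (density lborel \<phi>) (A n)"
      using \<phi>m Am by (simp add: emeasure_density)
    finally show ?thesis .
  qed
  then have "ennreal m \<le> emeasure (density lborel \<phi>) (\<Inter>n. A n)"
    by (intro LIMSEQ_le_const[OF tend]) auto
  then show False using m by (simp add: emp)
qed

section \<open>Bounded level sets of Bergman functions\<close>

text \<open>
  Functions in \<open>A\<^sup>q\<^sub>\<nu>\<close> vanish at the boundary in the weighted sense. Because \<open>tq = \<nu> + 2\<close>, on a level set
  the integrand \<open>|g|\<^sup>q y\<^sup>\<nu>\<close> dominates a multiple of the hyperbolic area element, and the discs about
  points of one level set stay in a lower one.
\<close>
lemma level_set_bergman_in_box:
  fixes q \<nu> t \<eta> :: real
  assumes g: "g \<in> bergman_space q \<nu>"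
    and bd: "\<And>z. z \<in> upper_half_plane \<Longrightarrow> norm (g z) * Im z powr t \<le> M"
    and q: "q > 0" and \<nu>: "\<nu> > -1" and t: "t = (\<nu> + 2) / q" and \<eta>: "\<eta> > 0"
  shows "\<exists>R>0. level_set \<eta> t g \<subseteq> half_plane_box R"
proof -
  have t0: "t \<ge> 0" using q \<nu> t by simp
  have hol: "g holomorphic_on upper_half_plane" using g by (simp add: bergman_space_def)
  obtain \<rho> where \<rho>: "0 < \<rho>" "\<rho> \<le> 1 / 2"
    "\<And>z. z \<in> level_set \<eta> t g \<Longrightarrow> ball z (\<rho> * Im z) \<subseteq> level_set (\<eta> / 2) t g"
    using hyperbolic_neighbourhood_in_level_set[OF hol bd t0, of "\<eta> / 2" \<eta>] \<eta> by auto
  define U where "U = (\<Union>z\<in>level_set \<eta> t g. ball z (\<rho> * Im z))"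
  define c where "c = (\<eta> / 2) powr q"
  have c: "c > 0" using \<eta> by (simp add: c_def)
  have U: "U \<subseteq> level_set (\<eta> / 2) t g" using \<rho>(3) by (auto simp: U_def)
  have oU: "open U" by (auto simp: U_def)
  have m: "(\<lambda>z. ennreal (c * Im z powr (- 2)) * indicator U z) \<in> borel_measurable borel"
    using borel_open[OF oU] by simp
  have "(\<integral>\<^sup>+z\<in>U. ennreal (c * Im z powr (- 2)) \<partial>lborel)
     = (\<integral>\<^sup>+y. (\<integral>\<^sup>+x. ennreal (c * y powr (- 2)) * indicator U (Complex x y) \<partial>lborel) \<partial>lborel)"
    using nn_integral_lborel_complex[OF m] by simp
  also have "\<dots> \<le> (\<integral>\<^sup>+y\<in>{0<..}. (\<integral>\<^sup>+x. ennreal (norm (g (Complex x y)) powr q * y powr \<nu>) \<partial>lborel) \<partial>lborel)"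
  proof (intro nn_integral_mono)
    fix y :: real
    show "(\<integral>\<^sup>+x. ennreal (c * y powr (- 2)) * indicator U (Complex x y) \<partial>lborel)
      \<le> (\<integral>\<^sup>+x. ennreal (norm (g (Complex x y)) powr q * y powr \<nu>) \<partial>lborel) * indicator {0<..} y"
    proof (cases "y > 0")
      case True
      have "ennreal (c * y powr (- 2)) * indicator U (Complex x y)
          \<le> ennreal (norm (g (Complex x y)) powr q * y powr \<nu>)" for x
      proof (cases "Complex x y \<in> U")
        case inU: True
        then have "\<eta> / 2 \<le> norm (g (Complex x y)) * y powr t"
          using U by (auto simp: level_set_def)
        then have "c \<le> (norm (g (Complex x y)) * y powr t) powr q"
          unfolding c_def using \<eta> q by (intro powr_mono2) auto
        also have "\<dots> = norm (g (Complex x y)) powr q * y powr (\<nu> + 2)"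
          using q by (simp add: powr_mult powr_powr t)
        finally have "c * y powr (- 2) \<le> norm (g (Complex x y)) powr q * y powr (\<nu> + 2) * y powr (- 2)"
          by (intro mult_right_mono) auto
        also have "\<dots> = norm (g (Complex x y)) powr q * y powr \<nu>"
          by (simp add: mult.assoc powr_add[symmetric])
        finally show ?thesis using inU by (simp add: ennreal_leI)
      qed simp
      then show ?thesis using True by (auto intro!: nn_integral_mono)
    next
      case False
      have "Complex x y \<notin> U" for x
        using U False by (auto simp: level_set_def upper_half_plane_def)
      then show ?thesis by simp
    qed
  qed
  also have "\<dots> < \<infinity>"
    using g by (simp add: bergman_space_def bergman_norm_def ennreal_powr_less_top_iff del: infinity_ennreal_def)
  finally have "(\<integral>\<^sup>+z\<in>U. ennreal (c * Im z powr (- 2)) \<partial>lborel) < \<infinity>" .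
  then show ?thesis
    using finite_area_imp_in_half_plane_box[OF _ \<rho>(1,2) c, of "level_set \<eta> t g"]
    by (simp add: U_def level_set_def)
qed

section \<open>The kernel integral detects bounded level sets\<close>

text \<open>
  Already the disc about \<open>z\<^sub>0\<close> contributes a multiple of \<open>(Im z)\<^sup>-\<^sup>t\<close>: its area is of order
  \<open>y\<^sub>0\<^sup>2\<close>, and there \<open>|cnj w - z| \<le> 3 y\<^sub>0\<close> while \<open>Im w\<close> is comparable to \<open>y\<^sub>0\<close>.
\<close>
lemma level_set_kernel_integral_lower_bound:
  fixes \<beta> t \<rho> :: real
  assumes B: "ball z\<^sub>0 (\<rho> * Im z\<^sub>0) \<subseteq> V" and y: "Im z\<^sub>0 > 0" and \<rho>: "0 < \<rho>" "\<rho> \<le> 1 / 2"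
    and z: "z \<in> ball z\<^sub>0 (\<rho> * Im z\<^sub>0)" and \<beta>: "\<beta> > -2"
  shows "ennreal (2 powr (-\<bar>\<beta> - t\<bar>) * 3 powr (-(\<beta> + 2)) * pi * \<rho>\<^sup>2 * 2 powr (-\<bar>t\<bar>) * Im z powr (- t))
    \<le> (\<integral>\<^sup>+w\<in>V. ennreal (Im w powr (\<beta> - t) / norm (cnj w - z) powr (\<beta> + 2)) \<partial>lborel)"
proof -
  let ?B = "ball z\<^sub>0 (\<rho> * Im z\<^sub>0)" and ?y = "Im z\<^sub>0"
  note cz = Im_comparable_in_ball[OF z \<rho>(2) y]
  define k where "k = 2 powr (-\<bar>\<beta> - t\<bar>) * ?y powr (\<beta> - t) / (3 * ?y) powr (\<beta> + 2)"
  have k: "k \<ge> 0" by (simp add: k_def)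
  have "2 powr (-\<bar>- t\<bar>) * Im z powr (- t) \<le> ?y powr (- t)"
    by (rule powr_comparable) (use cz y in auto)
  then have "(2 powr (-\<bar>\<beta> - t\<bar>) * 3 powr (-(\<beta> + 2)) * pi * \<rho>\<^sup>2) * (2 powr (-\<bar>t\<bar>) * Im z powr (- t))
      \<le> (2 powr (-\<bar>\<beta> - t\<bar>) * 3 powr (-(\<beta> + 2)) * pi * \<rho>\<^sup>2) * ?y powr (- t)"
    by (intro mult_left_mono) auto
  also have "\<dots> = k * (pi * (\<rho> * ?y)\<^sup>2)"
  proof -
    have "?y powr (- t) = ?y powr (\<beta> - t) * ?y powr (-(\<beta> + 2)) * ?y powr 2"
      by (simp add: powr_add[symmetric])
    also have "?y powr 2 = ?y\<^sup>2" using y by (simp add: powr_numeral)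
    finally have *: "?y powr (- t) = ?y powr (\<beta> - t) * ?y powr (-(\<beta> + 2)) * ?y\<^sup>2" .
    have "k = 2 powr (-\<bar>\<beta> - t\<bar>) * ?y powr (\<beta> - t) * (3 powr (-(\<beta> + 2)) * ?y powr (-(\<beta> + 2)))"
      unfolding k_def powr_minus_divide using y by (simp add: powr_mult)
    then show ?thesis unfolding * by (simp add: power_mult_distrib mult_ac)
  qed
  finally have "ennreal (2 powr (-\<bar>\<beta> - t\<bar>) * 3 powr (-(\<beta> + 2)) * pi * \<rho>\<^sup>2 * 2 powr (-\<bar>t\<bar>) * Im z powr (- t))
      \<le> ennreal (k * (pi * (\<rho> * ?y)\<^sup>2))"
    by (intro ennreal_leI) (simp add: mult_ac)
  also have "\<dots> = ennreal k * emeasure lborel ?B"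
    using y \<rho> k by (subst emeasure_ball_complex) (auto simp: ennreal_mult)
  also have "\<dots> = (\<integral>\<^sup>+w. ennreal k * indicator ?B w \<partial>lborel)"
    by (simp add: nn_integral_cmult_indicator)
  also have "\<dots> \<le> (\<integral>\<^sup>+w\<in>V. ennreal (Im w powr (\<beta> - t) / norm (cnj w - z) powr (\<beta> + 2)) \<partial>lborel)"
  proof (intro nn_integral_mono)
    fix w
    show "ennreal k * indicator ?B w
      \<le> ennreal (Im w powr (\<beta> - t) / norm (cnj w - z) powr (\<beta> + 2)) * indicator V w"
    proof (cases "w \<in> ?B")
      case True
      note cw = Im_comparable_in_ball[OF True \<rho>(2) y]
      have "Im (z - cnj w) > 0" using cz cw y by simp
      then have pos: "norm (cnj w - z) > 0" by (auto simp: complex_eq_iff)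
      have r: "\<rho> * ?y \<le> 1 / 2 * ?y" using \<rho> y by (intro mult_right_mono) auto
      have "norm (cnj w - z) \<le> norm (cnj (w - z\<^sub>0)) + norm (cnj z\<^sub>0 - z\<^sub>0) + norm (z\<^sub>0 - z)"
        using norm_triangle_ineq[of "cnj (w - z\<^sub>0) + (cnj z\<^sub>0 - z\<^sub>0)" "z\<^sub>0 - z"]
          norm_triangle_ineq[of "cnj (w - z\<^sub>0)" "cnj z\<^sub>0 - z\<^sub>0"] by (simp add: algebra_simps)
      also have "norm (cnj (w - z\<^sub>0)) \<le> ?y / 2"
        using True r unfolding complex_mod_cnj by (simp add: dist_norm norm_minus_commute)
      also have "norm (z\<^sub>0 - z) \<le> ?y / 2" using z r by (simp add: dist_norm)
      also have "norm (cnj z\<^sub>0 - z\<^sub>0) = 2 * ?y"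
        using y by (simp add: cmod_def power2_eq_square real_sqrt_mult)
      finally have "norm (cnj w - z) \<le> 3 * ?y" by simp
      then have "norm (cnj w - z) powr (\<beta> + 2) \<le> (3 * ?y) powr (\<beta> + 2)"
        using \<beta> by (intro powr_mono2) auto
      moreover have "2 powr (-\<bar>\<beta> - t\<bar>) * ?y powr (\<beta> - t) \<le> Im w powr (\<beta> - t)"
        by (rule powr_comparable) (use cw y in auto)
      ultimately have "k \<le> Im w powr (\<beta> - t) / norm (cnj w - z) powr (\<beta> + 2)"
        unfolding k_def using pos by (intro frac_le) auto
      then show ?thesis using True B by (auto simp: ennreal_leI subset_eq)
    qed simp
  qed
  finally show ?thesis .
qed

text \<open>
  By the lower bound, the \<open>q\<close>-th power of the inner integral times \<open>y\<^sup>\<nu>\<close> is at least a multiple of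
  \<open>y\<^sup>-\<^sup>2\<close> near the level set of any height above \<open>\<epsilon>\<close>, which therefore has a neighbourhood of finite
  hyperbolic area.
\<close>
lemma level_set_in_box_if_kernel_integral_finite:
  fixes q \<nu> t \<beta> \<epsilon> \<epsilon>' M :: real
  assumes hol: "f holomorphic_on upper_half_plane"
    and bd: "\<And>z. z \<in> upper_half_plane \<Longrightarrow> norm (f z) * Im z powr t \<le> M"
    and q: "q > 0" and \<nu>: "\<nu> > -1" and t: "t = (\<nu> + 2) / q" and \<beta>: "\<beta> > -2" and \<epsilon>: "\<epsilon> < \<epsilon>'"
    and fin: "(\<integral>\<^sup>+z\<in>upper_half_plane.
           (ennreal_powr
              (\<integral>\<^sup>+w\<in>level_set \<epsilon> t f.
                 ennreal (Im w powr (\<beta> - t) / norm (cnj w - z) powr (\<beta> + 2)) \<partial>lborel) q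
            * ennreal (Im z powr \<nu>)) \<partial>lborel) < \<infinity>"
  shows "\<exists>R>0. level_set \<epsilon>' t f \<subseteq> half_plane_box R"
proof -
  have t0: "t \<ge> 0" using q \<nu> t by simp
  obtain \<rho> where \<rho>: "0 < \<rho>" "\<rho> \<le> 1 / 2"
    "\<And>z. z \<in> level_set \<epsilon>' t f \<Longrightarrow> ball z (\<rho> * Im z) \<subseteq> level_set \<epsilon> t f"
    using hyperbolic_neighbourhood_in_level_set[OF hol bd t0 \<epsilon>] by auto
  define k where "k = 2 powr (-\<bar>\<beta> - t\<bar>) * 3 powr (-(\<beta> + 2)) * pi * \<rho>\<^sup>2 * 2 powr (-\<bar>t\<bar>)"
  have k: "k > 0" using \<rho> by (simp add: k_def)
  let ?I = "\<lambda>z. \<integral>\<^sup>+w\<in>level_set \<epsilon> t f. ennreal (Im w powr (\<beta> - t) / norm (cnj w - z) powr (\<beta> + 2)) \<partial>lborel"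
  define U where "U = (\<Union>z\<in>level_set \<epsilon>' t f. ball z (\<rho> * Im z))"
  have "(\<integral>\<^sup>+z\<in>U. ennreal (k powr q * Im z powr (- 2)) \<partial>lborel)
    \<le> (\<integral>\<^sup>+z\<in>upper_half_plane. (ennreal_powr (?I z) q * ennreal (Im z powr \<nu>)) \<partial>lborel)"
  proof (intro nn_integral_mono)
    fix z
    show "ennreal (k powr q * Im z powr (- 2)) * indicator U z
      \<le> ennreal_powr (?I z) q * ennreal (Im z powr \<nu>) * indicator upper_half_plane z"
    proof (cases "z \<in> U")
      case True
      then obtain z\<^sub>0 where z\<^sub>0: "z\<^sub>0 \<in> level_set \<epsilon>' t f" and z: "z \<in> ball z\<^sub>0 (\<rho> * Im z\<^sub>0)"
        by (auto simp: U_def)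
      have y: "Im z\<^sub>0 > 0" using z\<^sub>0 by (simp add: level_set_def upper_half_plane_def)
      have zu: "z \<in> upper_half_plane" using \<rho>(3)[OF z\<^sub>0] z by (auto simp: level_set_def)
      have "ennreal (k * Im z powr (- t)) \<le> ?I z"
        using level_set_kernel_integral_lower_bound[OF \<rho>(3)[OF z\<^sub>0] y \<rho>(1,2) z \<beta>, of t]
        by (simp add: k_def)
      then have "ennreal ((k * Im z powr (- t)) powr q) \<le> ennreal_powr (?I z) q"
        using k q by (intro ennreal_powr_lower) auto
      then have "ennreal ((k * Im z powr (- t)) powr q) * ennreal (Im z powr \<nu>)
          \<le> ennreal_powr (?I z) q * ennreal (Im z powr \<nu>)"
        by (rule mult_right_mono) simp
      moreover have "(k * Im z powr (- t)) powr q * Im z powr \<nu> = k powr q * Im z powr (- 2)"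
      proof -
        have "(k * Im z powr (- t)) powr q = k powr q * Im z powr (-(\<nu> + 2))"
          using q k by (simp add: powr_mult powr_powr t)
        then show ?thesis by (simp add: mult.assoc powr_add[symmetric])
      qed
      ultimately show ?thesis
        using True zu by (simp add: ennreal_mult[symmetric])
    qed simp
  qed
  also note fin
  finally have "(\<integral>\<^sup>+z\<in>U. ennreal (k powr q * Im z powr (- 2)) \<partial>lborel) < \<infinity>" .
  then show ?thesis
    using finite_area_imp_in_half_plane_box[OF _ \<rho>(1,2), where c = "k powr q" and V = "level_set \<epsilon>' t f"] k
    by (simp add: U_def level_set_def)
qed

text \<open>
  For \<open>w\<close> in a fixed box, \<open>|cnj w - z|\<close> is bounded below by a multiple of \<open>|z + i|\<close>. The inner integral thus
  decays like \<open>|z + i|\<close> to the power \<open>-(\<beta> + 2)\<close>, fast enough for its \<open>q\<close>-th power to be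
  integrable against \<open>y\<^sup>\<nu>\<close>.
\<close>
lemma kernel_integral_finite_if_in_box:
  fixes q \<nu> t \<beta> R :: real
  assumes V: "V \<subseteq> half_plane_box R" and R: "R > 0"
    and q: "q > 0" and \<nu>: "\<nu> > -1" and \<beta>: "\<beta> > -2" "(\<beta> + 2) * q > \<nu> + 3"
  shows "(\<integral>\<^sup>+z\<in>upper_half_plane.
           (ennreal_powr
              (\<integral>\<^sup>+w\<in>V. ennreal (Im w powr (\<beta> - t) / norm (cnj w - z) powr (\<beta> + 2)) \<partial>lborel) q
            * ennreal (Im z powr \<nu>)) \<partial>lborel) < \<infinity>"
proof -
  let ?I = "\<lambda>z. \<integral>\<^sup>+w\<in>V. ennreal (Im w powr (\<beta> - t) / norm (cnj w - z) powr (\<beta> + 2)) \<partial>lborel"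
  let ?K = "half_plane_box R"
  define A where "A = (1 + R * (R + 1))"
  have A: "A > 0" using R by (auto simp: A_def intro: add_pos_nonneg)
  have "continuous_on ?K (\<lambda>w. Im w powr (\<beta> - t))"
    using half_plane_box_subset[OF R] by (auto intro!: continuous_intros simp: upper_half_plane_def)
  then have "compact ((\<lambda>w. Im w powr (\<beta> - t)) ` ?K)"
    by (rule compact_continuous_image[OF _ compact_half_plane_box])
  then obtain S0 where S0: "\<And>w. w \<in> ?K \<Longrightarrow> norm (Im w powr (\<beta> - t)) \<le> S0"
    by (metis bounded_iff compact_imp_bounded image_eqI)
  define S where "S = max S0 0"
  have S: "S \<ge> 0" "\<And>w. w \<in> ?K \<Longrightarrow> Im w powr (\<beta> - t) \<le> S"
    using S0 by (force simp: S_def)+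
  have fm: "emeasure lborel ?K < \<infinity>"
    using compact_imp_bounded[OF compact_half_plane_box] by (rule emeasure_bounded_finite)
  then obtain m where m: "emeasure lborel ?K = ennreal m" "m \<ge> 0"
    by (cases "emeasure lborel ?K") auto
  define k where "k = S * A powr (\<beta> + 2) * m"
  have k: "k \<ge> 0" using S A m by (simp add: k_def)
  have I: "?I z \<le> ennreal (k * norm (z + \<i>) powr (-(\<beta> + 2)))" if z: "z \<in> upper_half_plane" for z
  proof -
    have ker: "Im w powr (\<beta> - t) / norm (cnj w - z) powr (\<beta> + 2)
        \<le> S * A powr (\<beta> + 2) * norm (z + \<i>) powr (-(\<beta> + 2))" if w: "w \<in> ?K" for w
    proof -
      let ?d = "norm (cnj w - z)"
      have wv: "1 / R \<le> Im w" "norm w \<le> R" using w by (auto simp: half_plane_box_def)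
      have zi: "Im z > 0" using z by (simp add: upper_half_plane_def)
      have "1 / R \<le> \<bar>Im (cnj w - z)\<bar>" using wv zi by simp
      also have "\<dots> \<le> ?d" by (rule abs_Im_le_cmod)
      finally have d: "1 / R \<le> ?d" .
      have dpos: "?d > 0" using d R by (meson divide_pos_pos less_le_trans zero_less_one)
      have "norm (z + \<i>) \<le> ?d + norm (cnj w) + norm \<i>"
        using norm_triangle_ineq[of "z - cnj w + cnj w" \<i>] norm_triangle_ineq[of "z - cnj w" "cnj w"]
        by (simp add: norm_minus_commute)
      also have "\<dots> \<le> ?d + (R + 1)" using wv by simp
      also have "R + 1 \<le> (R + 1) * (R * ?d)"
        using mult_left_mono[of 1 "R * ?d" "R + 1"] d R by (simp add: field_simps)
      finally have zd: "norm (z + \<i>) \<le> A * ?d" by (simp add: A_def algebra_simps)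
      have zip: "norm (z + \<i>) > 0" using zi by (auto simp: complex_eq_iff)
      have "norm (z + \<i>) powr (\<beta> + 2) \<le> (A * ?d) powr (\<beta> + 2)"
        using zd \<beta> by (intro powr_mono2) auto
      also have "\<dots> = A powr (\<beta> + 2) * ?d powr (\<beta> + 2)" using A by (simp add: powr_mult)
      finally have "1 / ?d powr (\<beta> + 2) \<le> A powr (\<beta> + 2) * norm (z + \<i>) powr (-(\<beta> + 2))"
        unfolding powr_minus_divide using zip dpos by (simp add: field_simps)
      then have "Im w powr (\<beta> - t) * (1 / ?d powr (\<beta> + 2))
          \<le> S * (A powr (\<beta> + 2) * norm (z + \<i>) powr (-(\<beta> + 2)))"
        using S w by (intro mult_mono) auto
      then show ?thesis by (simp add: mult_ac)
    qed
    have "?I z \<le> (\<integral>\<^sup>+w. ennreal (S * A powr (\<beta> + 2) * norm (z + \<i>) powr (-(\<beta> + 2))) * indicator ?K w \<partial>lborel)"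
      using V ker by (intro nn_integral_mono) (auto simp: indicator_def intro!: ennreal_leI)
    also have "\<dots> = ennreal (S * A powr (\<beta> + 2) * norm (z + \<i>) powr (-(\<beta> + 2))) * ennreal m"
      using compact_imp_closed[OF compact_half_plane_box] m by (subst nn_integral_cmult_indicator) auto
    also have "\<dots> = ennreal (k * norm (z + \<i>) powr (-(\<beta> + 2)))"
      using S m by (simp add: ennreal_mult[symmetric] k_def mult_ac)
    finally show ?thesis .
  qed
  have "(\<integral>\<^sup>+z\<in>upper_half_plane. (ennreal_powr (?I z) q * ennreal (Im z powr \<nu>)) \<partial>lborel)
    \<le> (\<integral>\<^sup>+z\<in>upper_half_plane. ennreal (k powr q * (norm (z + \<i>) powr (-((\<beta> + 2) * q)) * Im z powr \<nu>)) \<partial>lborel)"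
  proof (intro nn_integral_mono)
    fix z
    show "ennreal_powr (?I z) q * ennreal (Im z powr \<nu>) * indicator upper_half_plane z
      \<le> ennreal (k powr q * (norm (z + \<i>) powr (-((\<beta> + 2) * q)) * Im z powr \<nu>)) * indicator upper_half_plane z"
    proof (cases "z \<in> upper_half_plane")
      case True
      have "ennreal_powr (?I z) q \<le> ennreal ((k * norm (z + \<i>) powr (-(\<beta> + 2))) powr q)"
        using I[OF True] k q by (intro ennreal_powr_upper) auto
      also have "(k * norm (z + \<i>) powr (-(\<beta> + 2))) powr q = k powr q * norm (z + \<i>) powr (-((\<beta> + 2) * q))"
        by (simp only: powr_mult powr_powr minus_mult_left)
      finally have "ennreal_powr (?I z) q * ennreal (Im z powr \<nu>)
          \<le> ennreal (k powr q * norm (z + \<i>) powr (-((\<beta> + 2) * q))) * ennreal (Im z powr \<nu>)"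
        by (rule mult_right_mono) simp
      then show ?thesis using True by (simp add: ennreal_mult[symmetric] mult.assoc)
    qed simp
  qed
  also have "\<dots> < \<infinity>"
    by (rule decay_nn_integral) (use \<nu> \<beta> in auto)
  finally show ?thesis .
qed

section \<open>Approximation by rapidly decaying functions\<close>

text \<open>
  For large \<open>k\<close> this is a vector space inside \<open>A\<^sup>q\<^sub>\<nu>\<close> that is easier to handle than the latter: membership
  is a pointwise bound, from which vanishing at the boundary follows.
\<close>
definition decay_space :: "nat \<Rightarrow> (complex \<Rightarrow> complex) set" where
  "decay_space k = {g. g holomorphic_on upper_half_plane \<and>
     (\<exists>C\<ge>0. \<forall>z\<in>upper_half_plane. norm (g z) \<le> C * norm (z + \<i>) powr (- real k))}"

lemma decay_space_zero: "(\<lambda>z. 0) \<in> decay_space k"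
  by (auto simp: decay_space_def intro!: exI[of _ 0])

lemma decay_space_add:
  assumes "g \<in> decay_space k" "h \<in> decay_space k"
  shows "(\<lambda>z. g z + h z) \<in> decay_space k"
proof -
  obtain C D where C: "C \<ge> 0" "\<And>z. z \<in> upper_half_plane \<Longrightarrow> norm (g z) \<le> C * norm (z + \<i>) powr (- real k)"
    and D: "D \<ge> 0" "\<And>z. z \<in> upper_half_plane \<Longrightarrow> norm (h z) \<le> D * norm (z + \<i>) powr (- real k)"
    using assms unfolding decay_space_def by blast
  have "norm (g z + h z) \<le> (C + D) * norm (z + \<i>) powr (- real k)" if "z \<in> upper_half_plane" for z
    using norm_triangle_ineq[of "g z" "h z"] C(2)[OF that] D(2)[OF that] by (simp add: distrib_right)
  then show ?thesis
    using assms C D unfolding decay_space_def by (auto intro!: holomorphic_intros exI[of _ "C + D"])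
qed

lemma decay_space_scale:
  assumes "g \<in> decay_space k"
  shows "(\<lambda>z. c * g z) \<in> decay_space k"
proof -
  obtain C where C: "C \<ge> 0" "\<And>z. z \<in> upper_half_plane \<Longrightarrow> norm (g z) \<le> C * norm (z + \<i>) powr (- real k)"
    using assms unfolding decay_space_def by blast
  have "norm (c * g z) \<le> (norm c * C) * norm (z + \<i>) powr (- real k)" if "z \<in> upper_half_plane" for z
    using mult_left_mono[OF C(2)[OF that], of "norm c"] by (simp add: norm_mult mult.assoc)
  then show ?thesis
    using assms C unfolding decay_space_def by (auto intro!: holomorphic_intros exI[of _ "norm c * C"])
qed

lemma decay_space_subset_bergman_space:
  assumes "q > 0" "\<nu> > -1" "real k * q > \<nu> + 3"
  shows "decay_space k \<subseteq> bergman_space q \<nu>"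
proof
  fix g assume g: "g \<in> decay_space k"
  then obtain C where C: "C \<ge> 0" "\<And>z. z \<in> upper_half_plane \<Longrightarrow> norm (g z) \<le> C * norm (z + \<i>) powr (- real k)"
    unfolding decay_space_def by blast
  let ?G = "\<lambda>z. ennreal (C powr q * (norm (z + \<i>) powr (-(real k * q)) * Im z powr \<nu>))"
  have G: "?G \<in> borel_measurable borel" by measurable
  have "(\<integral>\<^sup>+y\<in>{0<..}. (\<integral>\<^sup>+x. ennreal (norm (g (Complex x y)) powr q * y powr \<nu>) \<partial>lborel) \<partial>lborel)
    \<le> (\<integral>\<^sup>+y\<in>{0<..}. (\<integral>\<^sup>+x. ?G (Complex x y) \<partial>lborel) \<partial>lborel)"
  proof (intro nn_integral_mono)
    fix y :: real
    show "(\<integral>\<^sup>+x. ennreal (norm (g (Complex x y)) powr q * y powr \<nu>) \<partial>lborel) * indicator {0<..} y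
      \<le> (\<integral>\<^sup>+x. ?G (Complex x y) \<partial>lborel) * indicator {0<..} y"
    proof (cases "y > 0")
      case True
      have "ennreal (norm (g (Complex x y)) powr q * y powr \<nu>) \<le> ?G (Complex x y)" for x
      proof -
        have "norm (g (Complex x y)) powr q \<le> (C * norm (Complex x y + \<i>) powr (- real k)) powr q"
          using C(2)[of "Complex x y"] True assms by (intro powr_mono2) (auto simp: upper_half_plane_def)
        also have "\<dots> = C powr q * norm (Complex x y + \<i>) powr (-(real k * q))"
          by (simp only: powr_mult powr_powr minus_mult_left)
        finally have "norm (g (Complex x y)) powr q * y powr \<nu>
            \<le> C powr q * norm (Complex x y + \<i>) powr (-(real k * q)) * y powr \<nu>"
          by (rule mult_right_mono) simp
        then show ?thesis by (intro ennreal_leI) (simp add: mult.assoc)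
      qed
      then show ?thesis by (intro mult_right_mono nn_integral_mono) auto
    qed simp
  qed
  also have "\<dots> = (\<integral>\<^sup>+z\<in>upper_half_plane. ?G z \<partial>lborel)"
    by (rule nn_integral_upper_half_plane[OF G, symmetric])
  also have "\<dots> < \<infinity>"
    by (rule decay_nn_integral) (use assms in auto)
  finally show "g \<in> bergman_space q \<nu>"
    using g unfolding bergman_space_def bergman_norm_def ennreal_powr_less_top_iff decay_space_def by simp
qed

lemma norm_add_ii_ge:
  assumes "z \<in> upper_half_plane"
  shows "1 \<le> norm (z + \<i>)" "norm z \<le> norm (z + \<i>)" "Im z \<le> norm (z + \<i>)"
proof -
  have y: "Im z > 0" using assms by (simp add: upper_half_plane_def)
  have "\<bar>Im (z + \<i>)\<bar> \<le> norm (z + \<i>)" by (rule abs_Im_le_cmod)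
  then show "1 \<le> norm (z + \<i>)" "Im z \<le> norm (z + \<i>)" using y by auto
  show "norm z \<le> norm (z + \<i>)"
    by (rule power2_le_imp_le) (use y in \<open>auto simp: cmod_power2 intro!: power_mono\<close>)
qed

text \<open>
  Off a large box either the height is small, and the weight \<open>y\<^sup>t\<close> wins, or \<open>|z|\<close> is large, and the
  decay beats the weight because of \<open>k \<ge> t + 1\<close>.
\<close>
lemma decay_space_vanishes_at_boundary:
  assumes g: "g \<in> decay_space k" and t: "t > 0" "real k \<ge> t + 1" and \<delta>: "\<delta> > 0"
  shows "\<exists>R\<ge>R\<^sub>0. \<forall>z\<in>upper_half_plane - half_plane_box R. norm (g z) * Im z powr t \<le> \<delta>"
proof -
  obtain C where C: "C \<ge> 0" "\<And>z. z \<in> upper_half_plane \<Longrightarrow> norm (g z) \<le> C * norm (z + \<i>) powr (- real k)"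
    using g unfolding decay_space_def by blast
  define R where "R = max (max R\<^sub>0 1) (max (C / \<delta>) ((C / \<delta>) powr (1 / t)))"
  have R: "R \<ge> R\<^sub>0" "R \<ge> 1" "R \<ge> C / \<delta>" "R \<ge> (C / \<delta>) powr (1 / t)" by (auto simp: R_def)
  have "norm (g z) * Im z powr t \<le> \<delta>" if z: "z \<in> upper_half_plane" "z \<notin> half_plane_box R" for z
  proof -
    note n = norm_add_ii_ge[OF z(1)]
    let ?n = "norm (z + \<i>)"
    have y: "Im z > 0" using z by (simp add: upper_half_plane_def)
    have "norm (g z) * Im z powr t \<le> C * ?n powr (- real k) * Im z powr t"
      using C(2)[OF z(1)] by (rule mult_right_mono) simp
    also have "\<dots> \<le> \<delta>"
    proof (cases "1 / R \<le> Im z")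
      case False
      have "?n powr (- real k) \<le> 1"
        using powr_mono[of "- real k" 0 ?n] n(1) by (auto split: if_splits)
      moreover have "Im z powr t \<le> (1 / R) powr t"
        using False y t by (intro powr_mono2) auto
      ultimately have "C * ?n powr (- real k) * Im z powr t \<le> C * 1 * (1 / R) powr t"
        using C by (intro mult_mono) auto
      also have "\<dots> = C / R powr t" using R by (simp add: powr_divide)
      also have "\<dots> \<le> \<delta>"
      proof -
        have "C / \<delta> = ((C / \<delta>) powr (1 / t)) powr t"
          using C \<delta> t by (simp add: powr_powr)
        also have "\<dots> \<le> R powr t" using R t by (intro powr_mono2) auto
        finally show ?thesis using R \<delta> by (simp add: field_simps)
      qed
      finally show ?thesis .
    next
      case True
      then have nR: "R \<le> ?n" using z y n by (auto simp: half_plane_box_def)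
      have "Im z powr t \<le> ?n powr t"
        using n y t by (intro powr_mono2) auto
      then have "C * ?n powr (- real k) * Im z powr t \<le> C * ?n powr (- real k) * ?n powr t"
        using C by (intro mult_left_mono) auto
      also have "\<dots> = C * ?n powr (t - real k)"
        by (simp add: mult.assoc powr_add[symmetric])
      also have "\<dots> \<le> C * ?n powr (- 1)"
        using C t n by (intro mult_left_mono powr_mono) auto
      also have "\<dots> = C / ?n"
        using n(1) by (subst powr_minus_divide) (auto simp: powr_one)
      also have "\<dots> \<le> C / R"
        using nR R C by (intro divide_left_mono mult_pos_pos) auto
      also have "\<dots> \<le> \<delta>" using R \<delta> by (simp add: field_simps)
      finally show ?thesis .
    qed
    finally show ?thesis .
  qed
  then show ?thesis using R by auto
qed

text \<open>
  The approximants are \<open>f(z + is) / (1 - isz)\<^sup>k\<close> with small \<open>s > 0\<close>. The shift makes \<open>f\<close> bounded,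
  the factor supplies the decay, and neither increases the weighted supremum, since
  \<open>|1 - isz| \<ge> 1 + s Im z\<close>. They converge uniformly on boxes by joint continuity in \<open>s\<close> and \<open>z\<close>,
  down to \<open>s = 0\<close>.
\<close>
lemma decay_space_approximation:
  assumes hol: "f holomorphic_on upper_half_plane"
    and bd: "\<And>z. z \<in> upper_half_plane \<Longrightarrow> norm (f z) * Im z powr t \<le> M"
    and t: "t \<ge> 0" and R: "R > 0" and \<delta>: "\<delta> > 0"
  shows "\<exists>g\<in>decay_space k. (\<forall>z\<in>upper_half_plane. norm (g z) * Im z powr t \<le> M) \<and>
           (\<forall>z\<in>half_plane_box R. norm (f z - g z) * Im z powr t \<le> \<delta>)"
proof -
  let ?H = upper_half_plane
  \<comment> \<open>The weight is built into \<open>G\<close> so that uniform continuity gives the weighted estimate directly.\<close>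
  define G where "G = (\<lambda>(s, z). f (z + \<i> * of_real s) * (1 / (1 - \<i> * of_real s * z)) ^ k * of_real (Im z powr t))"
  have ge1: "1 + s * Im z \<le> norm (1 - \<i> * of_real s * z)" for s z
    using complex_Re_le_cmod[of "1 - \<i> * of_real s * z"] by simp
  have M: "M \<ge> 0" using bd by (rule growth_bound_nonneg)
  let ?D = "{0..1::real} \<times> half_plane_box R"
  have Kpos: "Im z > 0" if "z \<in> half_plane_box R" for z
    using that half_plane_box_subset[OF R] by (auto simp: upper_half_plane_def)
  have nz: "1 - \<i> * of_real s * z \<noteq> 0" if "s \<ge> 0" "Im z > 0" for s z
  proof -
    have "0 < 1 + s * Im z" using that by (simp add: add_pos_nonneg)
    also note ge1[of s z]
    finally show ?thesis unfolding zero_less_norm_iff .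
  qed
  have "continuous_on ?D (\<lambda>p. f (snd p + \<i> * of_real (fst p)))"
    by (rule continuous_on_compose2[OF holomorphic_on_imp_continuous_on[OF hol]])
       (use Kpos in \<open>auto intro!: continuous_intros simp: upper_half_plane_def intro!: add_pos_nonneg\<close>)
  moreover have "continuous_on ?D (\<lambda>p. (1 / (1 - \<i> * of_real (fst p) * snd p)) ^ k)"
    using nz Kpos by (intro continuous_intros) auto
  moreover have "continuous_on ?D (\<lambda>p. of_real (Im (snd p) powr t) :: complex)"
    using Kpos by (intro continuous_intros) fastforce+
  ultimately have "continuous_on ?D G"
    unfolding G_def split_beta' by (intro continuous_on_mult)
  then have "uniformly_continuous_on ?D G"
    by (rule compact_uniformly_continuous) (intro compact_Times compact_half_plane_box, simp)
  then obtain d where d: "d > 0" "\<And>p p'. p \<in> ?D \<Longrightarrow> p' \<in> ?D \<Longrightarrow> dist p' p < d \<Longrightarrow> dist (G p') (G p) < \<delta>"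
    unfolding uniformly_continuous_on_def using \<delta> by metis
  define s where "s = min 1 (d / 2)"
  have s: "0 < s" "s \<le> 1" "s < d" using d by (auto simp: s_def)
  define g where "g = (\<lambda>z. f (z + \<i> * of_real s) * (1 / (1 - \<i> * of_real s * z)) ^ k)"
  have shift: "z + \<i> * of_real s \<in> ?H" if "z \<in> ?H" for z
    using that s by (simp add: upper_half_plane_def)
  have fs: "norm (f (z + \<i> * of_real s)) * (Im z + s) powr t \<le> M" if "z \<in> ?H" for z
    using bd[OF shift[OF that]] by simp
  have "(f \<circ> (\<lambda>z. z + \<i> * of_real s)) holomorphic_on ?H"
    using shift by (intro holomorphic_on_compose_gen[OF _ hol] holomorphic_intros) auto
  then have ghol: "g holomorphic_on ?H"
    unfolding g_def o_def using nz s by (intro holomorphic_intros) (auto simp: upper_half_plane_def)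
  have gM: "norm (g z) * Im z powr t \<le> M" if z: "z \<in> ?H" for z
  proof -
    have y: "Im z > 0" using z by (simp add: upper_half_plane_def)
    have "1 \<le> norm (1 - \<i> * of_real s * z)"
      using ge1[of s z] mult_pos_pos[OF s(1) y] by linarith
    then have "norm ((1 / (1 - \<i> * of_real s * z)) ^ k) \<le> 1"
      unfolding norm_power norm_divide
      by (intro power_le_one) (auto simp: divide_le_eq)
    then have "norm (g z) \<le> norm (f (z + \<i> * of_real s))"
      unfolding g_def norm_mult by (rule mult_left_le) simp
    moreover have "Im z powr t \<le> (Im z + s) powr t" using y s t by (intro powr_mono2) auto
    ultimately have "norm (g z) * Im z powr t \<le> norm (f (z + \<i> * of_real s)) * (Im z + s) powr t"
      by (intro mult_mono) auto
    then show ?thesis using fs[OF z] by linarith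
  qed
  have dec: "norm (g z) \<le> (M / s powr t / s ^ k) * norm (z + \<i>) powr (- real k)" if z: "z \<in> ?H" for z
  proof -
    have y: "Im z > 0" using z by (simp add: upper_half_plane_def)
    note n = norm_add_ii_ge[OF z]
    have "norm (f (z + \<i> * of_real s)) * s powr t \<le> norm (f (z + \<i> * of_real s)) * (Im z + s) powr t"
      using y s t by (intro mult_left_mono powr_mono2) auto
    then have 1: "norm (f (z + \<i> * of_real s)) \<le> M / s powr t"
      using fs[OF z] s by (simp add: field_simps)
    \<comment> \<open>\<open>|1 - isz| = s |z + i/s|\<close>, and \<open>i/s\<close> lies at least as high as \<open>i\<close> because of \<open>s \<le> 1\<close>.\<close>
    have "s * norm (z + \<i>) \<le> norm (1 - \<i> * of_real s * z)"
    proof (rule power2_le_imp_le)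
      have "(s * norm (z + \<i>))\<^sup>2 = (s * Re z)\<^sup>2 + (s * (Im z + 1))\<^sup>2"
        unfolding power_mult_distrib cmod_power2 by (simp add: distrib_left)
      also have "\<dots> \<le> (s * Re z)\<^sup>2 + (1 + s * Im z)\<^sup>2"
        using s y by (intro add_left_mono power_mono) (auto simp: algebra_simps)
      also have "\<dots> = (norm (1 - \<i> * of_real s * z))\<^sup>2"
        by (simp add: cmod_power2)
      finally show "(s * norm (z + \<i>))\<^sup>2 \<le> (norm (1 - \<i> * of_real s * z))\<^sup>2" .
    qed simp
    then have "1 / norm (1 - \<i> * of_real s * z) \<le> 1 / (s * norm (z + \<i>))"
      using s n nz[of s z] y by (intro divide_left_mono mult_pos_pos) auto
    then have 2: "norm ((1 / (1 - \<i> * of_real s * z)) ^ k) \<le> (1 / (s * norm (z + \<i>))) ^ k"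
      unfolding norm_power norm_divide by (intro power_mono) auto
    have "norm (g z) \<le> (M / s powr t) * (1 / (s * norm (z + \<i>))) ^ k"
      unfolding g_def norm_mult using 1 2 M by (intro mult_mono) auto
    also have "\<dots> = (M / s powr t / s ^ k) * norm (z + \<i>) powr (- real k)"
      using n(1) by (subst powr_minus, subst powr_realpow) (auto simp: power_divide power_mult_distrib power_inverse divide_inverse mult_ac)
    finally show ?thesis .
  qed
  have "g \<in> decay_space k"
    unfolding decay_space_def using ghol dec M s by (auto intro!: exI[of _ "M / s powr t / s ^ k"])
  moreover have "norm (f z - g z) * Im z powr t \<le> \<delta>" if z: "z \<in> half_plane_box R" for z
  proof -
    have "dist (G (0, z)) (G (s, z)) < \<delta>"
      by (rule d(2)) (use z s in \<open>auto simp: dist_Pair_Pair\<close>)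
    moreover have "G (0, z) - G (s, z) = (f z - g z) * of_real (Im z powr t)"
      by (simp add: G_def g_def left_diff_distrib)
    ultimately show ?thesis by (simp add: dist_norm norm_mult)
  qed
  ultimately show ?thesis using gM by blast
qed

text \<open>
  Each new summand \<open>g\<close> is chosen so close to \<open>f\<close> on a box off which the previous sum \<open>G\<close> is negligible
  that every point pays the bad error \<open>2M\<close> at most once. Inside the box the new term costs \<open>\<delta>\<close>;
  outside it, the earlier terms cost at most \<open>N(L + \<delta>)\<close> whatever was paid before, because there \<open>f\<close> is
  bounded by \<open>L\<close> and \<open>G\<close> by \<open>N\<delta>\<close>.
\<close>
lemma gliding_hump:
  assumes hol: "f holomorphic_on upper_half_plane"
    and bd: "\<And>z. z \<in> upper_half_plane \<Longrightarrow> norm (f z) * Im z powr t \<le> M"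
    and t: "t > 0" "real k \<ge> t + 1" and \<delta>: "\<delta> > 0" and L: "L \<ge> 0" and R\<^sub>0: "R\<^sub>0 > 0"
    and out: "\<And>z. z \<in> upper_half_plane - half_plane_box R\<^sub>0 \<Longrightarrow> norm (f z) * Im z powr t \<le> L"
  shows "\<exists>G\<in>decay_space k. \<exists>R\<ge>R\<^sub>0.
     (\<forall>z\<in>upper_half_plane. norm (of_nat N * f z - G z) * Im z powr t \<le> real N * (L + \<delta>) + 2 * M) \<and>
     (\<forall>z\<in>upper_half_plane - half_plane_box R. norm (G z) * Im z powr t \<le> real N * \<delta>)"
proof (induction N)
  case 0
  have "M \<ge> 0" using bd by (rule growth_bound_nonneg)
  then show ?case by (intro bexI[of _ "\<lambda>z. 0"] exI[of _ R\<^sub>0]) (auto simp: decay_space_zero)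
next
  case (Suc N)
  let ?H = upper_half_plane
  obtain G R where G: "G \<in> decay_space k" and R: "R \<ge> R\<^sub>0"
    and Gf: "\<And>z. z \<in> ?H \<Longrightarrow> norm (of_nat N * f z - G z) * Im z powr t \<le> real N * (L + \<delta>) + 2 * M"
    and Go: "\<And>z. z \<in> ?H - half_plane_box R \<Longrightarrow> norm (G z) * Im z powr t \<le> real N * \<delta>"
    using Suc by blast
  have Rp: "R > 0" using R R\<^sub>0 by linarith
  obtain g where g: "g \<in> decay_space k" and gM: "\<And>z. z \<in> ?H \<Longrightarrow> norm (g z) * Im z powr t \<le> M"
    and gf: "\<And>z. z \<in> half_plane_box R \<Longrightarrow> norm (f z - g z) * Im z powr t \<le> \<delta>"
    using decay_space_approximation[OF hol bd less_imp_le[OF t(1)] Rp \<delta>, of k] by blast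
  obtain S where S: "S \<ge> R" and gS: "\<And>z. z \<in> ?H - half_plane_box S \<Longrightarrow> norm (g z) * Im z powr t \<le> \<delta>"
    using decay_space_vanishes_at_boundary[OF g t \<delta>, of R] by blast
  have RS: "half_plane_box R \<subseteq> half_plane_box S" by (rule half_plane_box_mono[OF Rp S])
  have R0R: "half_plane_box R\<^sub>0 \<subseteq> half_plane_box R" by (rule half_plane_box_mono[OF R\<^sub>0 R])
  show ?case
  proof (intro bexI[of _ "\<lambda>z. G z + g z"] exI[of _ S] conjI ballI)
    show "S \<ge> R\<^sub>0" using R S by linarith
    show "(\<lambda>z. G z + g z) \<in> decay_space k" by (rule decay_space_add[OF G g])
  next
    fix z assume z: "z \<in> ?H - half_plane_box S"
    have "norm (G z + g z) * Im z powr t \<le> (norm (G z) + norm (g z)) * Im z powr t"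
      by (intro mult_right_mono norm_triangle_ineq) simp
    also have "\<dots> \<le> real N * \<delta> + \<delta>"
      using Go[of z] gS[OF z] z RS by (auto simp: distrib_right intro!: add_mono)
    finally show "norm (G z + g z) * Im z powr t \<le> real (Suc N) * \<delta>" by (simp add: distrib_right)
  next
    fix z assume z: "z \<in> ?H"
    let ?p = "Im z powr t"
    have split: "norm (of_nat (Suc N) * f z - (G z + g z)) * ?p
        \<le> norm (of_nat N * f z - G z) * ?p + norm (f z - g z) * ?p"
    proof -
      have "of_nat (Suc N) * f z - (G z + g z) = (of_nat N * f z - G z) + (f z - g z)"
        by (simp add: algebra_simps)
      then show ?thesis
        by (metis distrib_right mult_right_mono norm_triangle_ineq powr_ge_zero)
    qed
    show "norm (of_nat (Suc N) * f z - (G z + g z)) * ?p \<le> real (Suc N) * (L + \<delta>) + 2 * M"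
    proof (cases "z \<in> half_plane_box R")
      case True
      then show ?thesis
        using split Gf[OF z] gf[OF True] L by (simp add: distrib_right)
    next
      case False
      have "norm (of_nat N * f z - G z) * ?p \<le> (real N * norm (f z) + norm (G z)) * ?p"
        by (intro mult_right_mono order_trans[OF norm_triangle_ineq4]) (auto simp: norm_mult)
      also have "\<dots> = real N * (norm (f z) * ?p) + norm (G z) * ?p" by (simp add: distrib_right)
      also have "\<dots> \<le> real N * L + real N * \<delta>"
        using out[of z] Go[of z] z False R0R by (intro add_mono mult_left_mono) auto
      finally have 1: "norm (of_nat N * f z - G z) * ?p \<le> real N * (L + \<delta>)"
        by (simp add: distrib_left)
      have "norm (f z - g z) * ?p \<le> (norm (f z) + norm (g z)) * ?p"
        by (intro mult_right_mono norm_triangle_ineq4) simp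
      also have "\<dots> \<le> 2 * M" using bd[OF z] gM[OF z] by (simp add: distrib_right)
      finally have 2: "norm (f z - g z) * ?p \<le> 2 * M" .
      have "real (Suc N) * (L + \<delta>) = real N * (L + \<delta>) + (L + \<delta>)" by (simp add: distrib_right)
      then show ?thesis using split 1 2 L \<delta> by linarith
    qed
  qed
qed

section \<open>The distance formula\<close>

text \<open>
  The average of the \<open>N\<close> functions from the gliding hump differs from \<open>f\<close> by \<open>L + \<delta> + 2M/N\<close> at
  most in the weighted norm.
\<close>
lemma norm_dist_le_if_level_set_in_box:
  fixes q \<nu> t L M :: real
  assumes hol: "f holomorphic_on upper_half_plane"
    and bd: "\<And>z. z \<in> upper_half_plane \<Longrightarrow> norm (f z) * Im z powr t \<le> M"
    and q: "q > 0" and \<nu>: "\<nu> > -1" and t: "t > 0" and R: "R > 0"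
    and L: "L > 0" "level_set L t f \<subseteq> half_plane_box R"
  shows "norm_dist (bergman_inf_norm t) f (bergman_space q \<nu>) \<le> ennreal L"
proof (rule ennreal_le_epsilon)
  fix e :: real assume e: "e > 0"
  have M: "M \<ge> 0" using bd by (rule growth_bound_nonneg)
  \<comment> \<open>The first bound makes the approximants vanish at the boundary, the second puts them into \<open>A\<^sup>q\<^sub>\<nu>\<close>.\<close>
  obtain k :: nat where k: "real k > max (t + 1) ((\<nu> + 3) / q)" using reals_Archimedean2 by blast
  have kq: "real k * q > \<nu> + 3" "real k \<ge> t + 1" using k q by (auto simp: field_simps)
  obtain N :: nat where N: "real N > 4 * M / e" using reals_Archimedean2 by blast
  then have N0: "real N > 0" using M e by (meson divide_nonneg_pos le_less_trans mult_nonneg_nonneg zero_le_numeral)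
  have out: "norm (f z) * Im z powr t \<le> L" if "z \<in> upper_half_plane - half_plane_box R" for z
    using that L by (auto simp: level_set_def)
  obtain G where G: "G \<in> decay_space k"
    and Gf: "\<And>z. z \<in> upper_half_plane \<Longrightarrow>
        norm (of_nat N * f z - G z) * Im z powr t \<le> real N * (L + e / 2) + 2 * M"
    using gliding_hump[OF hol bd t kq(2) _ less_imp_le[OF L(1)] R out, of "e / 2" N] e by auto
  define g where "g = (\<lambda>z. (1 / of_nat N) * G z)"
  have "g \<in> decay_space k" unfolding g_def by (rule decay_space_scale[OF G])
  then have g: "g \<in> bergman_space q \<nu>"
    using decay_space_subset_bergman_space[OF q \<nu> kq(1)] by blast
  have "bergman_inf_norm t (\<lambda>z. f z - g z) \<le> ennreal (L + e)"
  proof (subst bergman_inf_norm_le_iff)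
    show "0 \<le> L + e" using L e by simp
    show "\<forall>z\<in>upper_half_plane. norm (f z - g z) * Im z powr t \<le> L + e"
    proof
      fix z assume z: "z \<in> upper_half_plane"
      have "f z - g z = (1 / of_nat N) * (of_nat N * f z - G z)"
        using N0 by (simp add: g_def field_simps)
      then have "norm (f z - g z) = norm (of_nat N * f z - G z) / real N"
        by (simp add: norm_divide)
      then have "norm (f z - g z) * Im z powr t = norm (of_nat N * f z - G z) * Im z powr t / real N"
        by simp
      also have "\<dots> \<le> (real N * (L + e / 2) + 2 * M) / real N"
        using Gf[OF z] N0 by (intro divide_right_mono) auto
      also have "\<dots> = L + e / 2 + 2 * M / real N" using N0 by (simp add: field_simps)
      also have "2 * M / real N \<le> e / 2" using N N0 e by (simp add: field_simps)
      finally show "norm (f z - g z) * Im z powr t \<le> L + e" by simp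
    qed
  qed
  then have "norm_dist (bergman_inf_norm t) f (bergman_space q \<nu>) \<le> ennreal (L + e)"
    unfolding norm_dist_def using g by (meson INF_lower2)
  then show "norm_dist (bergman_inf_norm t) f (bergman_space q \<nu>) \<le> ennreal L + ennreal e"
    using L e by (simp add: ennreal_plus)
qed

theorem theorem2:
  fixes q \<nu> t \<beta> :: real and f :: "complex \<Rightarrow> complex"
  assumes "q > 1" and "\<nu> > -1"
    and "t = (\<nu> + 2) / q"
    and "\<beta> > max (\<nu> / q) ((\<nu> + 2) / q - 1)"
    and "f \<in> bergman_inf_space ((\<nu> + 2) / q)"
  shows "norm_dist (bergman_inf_norm ((\<nu> + 2) / q)) f (bergman_space q \<nu>) =
    (INF \<epsilon>\<in>{\<epsilon>::real. \<epsilon> > 0 \<and>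
        (\<integral>\<^sup>+z\<in>upper_half_plane.
           (ennreal_powr
              (\<integral>\<^sup>+w\<in>level_set \<epsilon> t f.
                 ennreal (Im w powr (\<beta> - t) / norm (cnj w - z) powr (\<beta> + 2)) \<partial>lborel) q
            * ennreal (Im z powr \<nu>)) \<partial>lborel) < \<infinity>}. ennreal \<epsilon>)"
    (is "?l1 = (INF \<epsilon>\<in>{\<epsilon>. \<epsilon> > 0 \<and> ?I \<epsilon> < \<infinity>}. ennreal \<epsilon>)")
proof -
  note q = \<open>q > 1\<close> and \<nu> = \<open>\<nu> > -1\<close> and t = \<open>t = (\<nu> + 2) / q\<close>
  have q0: "q > 0" using q by simp
  have t0: "t > 0" using q \<nu> t by simp
  have \<beta>t: "\<beta> > t - 1" using assms(4) t by simp
  then have \<beta>: "\<beta> > -2" using t0 by simp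
  \<comment> \<open>\<open>\<beta> > t - 1\<close> gives \<open>(\<beta> + 2) q > (t + 1) q = \<nu> + 2 + q\<close>, and \<open>q > 1\<close>.\<close>
  have \<beta>q: "(\<beta> + 2) * q > \<nu> + 3"
  proof -
    have "(t + 1) * q = \<nu> + 2 + q" using q t by (simp add: field_simps)
    moreover have "(t + 1) * q < (\<beta> + 2) * q" using \<beta>t q by (intro mult_strict_right_mono) auto
    ultimately show ?thesis using q by linarith
  qed
  have hol: "f holomorphic_on upper_half_plane"
    and "bergman_inf_norm t f < \<infinity>" using assms(5) t by (auto simp: bergman_inf_space_def)
  then obtain M where M: "bergman_inf_norm t f = ennreal M" "M \<ge> 0"
    by (cases "bergman_inf_norm t f") auto
  then have bd: "norm (f z) * Im z powr t \<le> M" if "z \<in> upper_half_plane" for z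
    using bergman_inf_norm_le_iff[of M t f] that by simp
  show ?thesis
    unfolding t[symmetric]
  proof (rule antisym)
    show "norm_dist (bergman_inf_norm t) f (bergman_space q \<nu>) \<le> (INF \<epsilon>\<in>{\<epsilon>. \<epsilon> > 0 \<and> ?I \<epsilon> < \<infinity>}. ennreal \<epsilon>)"
    proof (rule INF_greatest)
      fix \<epsilon> assume "\<epsilon> \<in> {\<epsilon>. \<epsilon> > 0 \<and> ?I \<epsilon> < \<infinity>}"
      then have \<epsilon>: "\<epsilon> > 0" "?I \<epsilon> < \<infinity>" by auto
      show "norm_dist (bergman_inf_norm t) f (bergman_space q \<nu>) \<le> ennreal \<epsilon>"
      proof (rule ennreal_le_epsilon)
        fix e :: real assume e: "e > 0"
        obtain R where R: "R > 0" "level_set (\<epsilon> + e) t f \<subseteq> half_plane_box R"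
          using level_set_in_box_if_kernel_integral_finite[OF hol bd q0 \<nu> t \<beta> _ \<epsilon>(2), of "\<epsilon> + e"] e by auto
        have "norm_dist (bergman_inf_norm t) f (bergman_space q \<nu>) \<le> ennreal (\<epsilon> + e)"
          using norm_dist_le_if_level_set_in_box[OF hol bd q0 \<nu> t0 R(1) _ R(2)] \<epsilon> e by simp
        then show "norm_dist (bergman_inf_norm t) f (bergman_space q \<nu>) \<le> ennreal \<epsilon> + ennreal e"
          using \<epsilon> e by (simp add: ennreal_plus)
      qed
    qed
    show "(INF \<epsilon>\<in>{\<epsilon>. \<epsilon> > 0 \<and> ?I \<epsilon> < \<infinity>}. ennreal \<epsilon>) \<le> norm_dist (bergman_inf_norm t) f (bergman_space q \<nu>)"
      unfolding norm_dist_def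
    proof (rule INF_greatest)
      fix g assume g: "g \<in> bergman_space q \<nu>"
      show "(INF \<epsilon>\<in>{\<epsilon>. \<epsilon> > 0 \<and> ?I \<epsilon> < \<infinity>}. ennreal \<epsilon>) \<le> bergman_inf_norm t (\<lambda>z. f z - g z)"
      proof (cases "bergman_inf_norm t (\<lambda>z. f z - g z) < \<infinity>")
        case True
        then obtain D where D: "bergman_inf_norm t (\<lambda>z. f z - g z) = ennreal D" "D \<ge> 0"
          by (cases "bergman_inf_norm t (\<lambda>z. f z - g z)") auto
        then have fg: "norm (f z - g z) * Im z powr t \<le> D" if "z \<in> upper_half_plane" for z
          using bergman_inf_norm_le_iff[of D t "\<lambda>z. f z - g z"] that by simp
        have tri: "norm (f z) * Im z powr t \<le> norm (g z) * Im z powr t + norm (f z - g z) * Im z powr t"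
          "norm (g z) * Im z powr t \<le> norm (f z) * Im z powr t + norm (f z - g z) * Im z powr t" for z
          unfolding distrib_right[symmetric]
          using norm_triangle_sub[of "f z" "g z"] norm_triangle_sub[of "g z" "f z"]
          by (auto intro!: mult_right_mono simp: norm_minus_commute)
        \<comment> \<open>\<open>g\<close> inherits a weighted bound from \<open>f\<close>, so its level sets are rigid as well.\<close>
        have gbd: "norm (g z) * Im z powr t \<le> M + D" if "z \<in> upper_half_plane" for z
          using tri(2)[of z] bd[OF that] fg[OF that] by linarith
        show ?thesis
        proof (rule ennreal_le_epsilon)
          fix e :: real assume e: "e > 0"
          obtain R where R: "R > 0" "level_set e t g \<subseteq> half_plane_box R"
            using level_set_bergman_in_box[OF g gbd q0 \<nu> t e] by blast
          have "level_set (D + e) t f \<subseteq> level_set e t g"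
          proof
            fix z assume z: "z \<in> level_set (D + e) t f"
            then show "z \<in> level_set e t g"
              using tri(1)[of z] fg[of z] by (simp add: level_set_def)
          qed
          then have "?I (D + e) < \<infinity>"
            using kernel_integral_finite_if_in_box[OF _ R(1) q0 \<nu> \<beta> \<beta>q] R(2) by blast
          then have "(INF \<epsilon>\<in>{\<epsilon>. \<epsilon> > 0 \<and> ?I \<epsilon> < \<infinity>}. ennreal \<epsilon>) \<le> ennreal (D + e)"
            using D e by (intro INF_lower) auto
          then show "(INF \<epsilon>\<in>{\<epsilon>. \<epsilon> > 0 \<and> ?I \<epsilon> < \<infinity>}. ennreal \<epsilon>)
              \<le> bergman_inf_norm t (\<lambda>z. f z - g z) + ennreal e"
            using D e by (simp add: ennreal_plus)
        qed
      next
        case False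
        then have "bergman_inf_norm t (\<lambda>z. f z - g z) = \<infinity>" by (metis infinity_ennreal_def less_top)
        then show ?thesis by simp
      qed
    qed
  qed
qed

end
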